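(* Let $A$ be a bigraded $K$-algebra satisfying conditions (i)--(iii) of the context, with fixed homogeneous generators $f_1,\ldots,f_m$ of $A_1$, $\deg f_i=d_i$, where $d_1\le d_2\le\cdots\le d_m$, and the corresponding presentation $\varphi:T=K[x_1,\ldots,x_n,y_1,\ldots,y_m]\to A$ with kernel $J$. Let $\mathbf w=(d_1,\ldots,d_m)$, let $<^*$ be a monomial order on $K[y_1,\ldots,y_m]$ with $y_1<^*\cdots<^*y_m$, and let $<'$ be the monomial order on $K[y_1,\ldots,y_m]$ given by $\mathbf y^{\mathbf a}<'\mathbf y^{\mathbf b}$ if $\mathbf a\cdot\mathbf w<\mathbf b\cdot\mathbf w$, or else $\mathbf a\cdot\mathbf w=\mathbf b\cdot\mathbf w$ and $\mathbf y^{\mathbf a}<^*\mathbf y^{\mathbf b}$. Let $<_x$ be a monomial order on $K[x_1,\ldots,x_n]$ and let $<$ be the product order on $T$ defined from $<'$ and $<_x$ in the context. Assume that $J$ satisfies the $x$-condition with respect to $<$. Then $A_k$ is componentwise linear for all $k\ge1$.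
   Context: Let $K$ be a field and $A=\bigoplus_{i,j}A_{(i,j)}$ a (commutative) bigraded $K$-algebra with $A_{(0,0)}=K$. Set $A_j=\bigoplus_iA_{(i,j)}$; then $A=\bigoplus_jA_j$ is a graded $A_0$-algebra, and each $A_j$ is a graded $A_0$-module with $(A_j)_i=A_{(i,j)}$. It is required that: (i) $A_0$ is the polynomial ring $S=K[x_1,\ldots,x_n]$ with the standard grading; (ii) $A_1$ is a finitely generated $S$-module and $(A_1)_i=0$ for $i<0$; (iii) $A=S[A_1]$, i.e. $A_i=A_1^i$ for all $i\ge1$. Fix homogeneous generators $f_1,\ldots,f_m$ of the $S$-module $A_1$ with $\deg f_i=d_i$. Let $T=K[x_1,\ldots,x_n,y_1,\ldots,y_m]$ be bigraded by $\deg x_i=(1,0)$, $\deg y_j=(d_j,1)$, and let $\varphi:T\to A$ be the surjective bigraded $K$-algebra homomorphism with $\varphi(x_i)=x_i$, $\varphi(y_j)=f_j$; $J=\operatorname{Ker}(\varphi)$. Notation: $\mathbf y^{\mathbf a}=y_1^{a_1}\cdots y_m^{a_m}$ and $\mathbf c\cdot\mathbf d=\sum_{i=1}^mc_id_i$. The product order $<$ on $T$ determined by $<'$ and $<_x$: for monomials $u,u'\in K[x_1,\ldots,x_n]$ and $w,w'\in K[y_1,\ldots,y_m]$, $uw<u'w'$ iff $w<'w'$, or $w=w'$ and $u<_xu'$. $J$ satisfies the $x$-condition with respect to a monomial order $<$ on $T$ if every minimal monomial generator of $\operatorname{in}_<(J)$ has the form $vw$ with $v\in S$ a monomial of degree $\le1$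 and $w\in K[y_1,\ldots,y_m]$ a monomial. For a graded $S$-module $M$, $M_{\langle k\rangle}$ is the submodule generated by all elements of degree $k$; $M$ is componentwise linear if $M_{\langle k\rangle}$ has a linear resolution for every $k$ (the zero module is regarded as having a linear resolution). *)

theory Defs
  imports Complex_Main "HOL-Library.Poly_Mapping" "HOL-Library.Function_Algebras"
begin

section \<open>Polynomial rings\<close>

text \<open>A monomial is identified with its exponent vector, so \<open>+\<close> on exponent vectors is
  multiplication of monomials and \<open>0\<close> is the monomial 1.  For a finite type \<open>'v\<close>,
  \<open>('v, 'k) polyn\<close> is the polynomial ring over \<open>'k\<close> in variables indexed by \<open>'v\<close>,
  with the convolution product of Poly_Mapping.\<close>

type_synonym 'v monom = "'v \<Rightarrow>\<^sub>0 nat"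
type_synonym ('v, 'k) polyn = "('v \<Rightarrow>\<^sub>0 nat) \<Rightarrow>\<^sub>0 'k"

definition Const :: "'k::field \<Rightarrow> ('v, 'k) polyn" where
  "Const c = Poly_Mapping.single 0 c"

definition mvar :: "'v \<Rightarrow> 'v monom" where
  "mvar v = Poly_Mapping.single v 1"

definition monom_poly :: "'v monom \<Rightarrow> ('v, 'k::field) polyn" where
  "monom_poly u = Poly_Mapping.single u 1"

definition Var :: "'v \<Rightarrow> ('v, 'k::field) polyn" where
  "Var v = monom_poly (mvar v)"

definition mdeg :: "('v::finite) monom \<Rightarrow> nat" where
  "mdeg u = (\<Sum>v\<in>UNIV. Poly_Mapping.lookup u v)"

text \<open>The homogeneous component of degree \<open>t\<close> in the standard grading; it is \<open>{0}\<close> for \<open>t < 0\<close>.\<close>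

definition hom_part :: "int \<Rightarrow> ('v::finite, 'k::field) polyn set" where
  "hom_part t = {p. \<forall>u\<in>Poly_Mapping.keys p. int (mdeg u) = t}"

definition poly_alg_hom ::
  "('k::field \<Rightarrow> 'a::comm_ring_1 \<Rightarrow> 'a) \<Rightarrow> (('v, 'k) polyn \<Rightarrow> 'a) \<Rightarrow> bool" where
  "poly_alg_hom scale h \<longleftrightarrow>
     h 1 = 1 \<and> (\<forall>p q. h (p + q) = h p + h q) \<and> (\<forall>p q. h (p * q) = h p * h q) \<and>
     (\<forall>c p. h (Const c * p) = scale c (h p))"


section \<open>Monomial orders and initial ideals\<close>

text \<open>Strict form of the order.  Since there are only finitely many variables, such an order is
  automatically a well-order.\<close>

definition monomial_order :: "(('v::finite) monom \<Rightarrow> 'v monom \<Rightarrow> bool) \<Rightarrow> bool" where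
  "monomial_order lt \<longleftrightarrow>
     (\<forall>u. \<not> lt u u) \<and> (\<forall>u v w. lt u v \<longrightarrow> lt v w \<longrightarrow> lt u w) \<and>
     (\<forall>u v. u \<noteq> v \<longrightarrow> lt u v \<or> lt v u) \<and>
     (\<forall>u. u \<noteq> 0 \<longrightarrow> lt 0 u) \<and>
     (\<forall>u v w. lt u v \<longrightarrow> lt (u + w) (v + w))"

definition lead_monom :: "('v monom \<Rightarrow> 'v monom \<Rightarrow> bool) \<Rightarrow> ('v, 'k::field) polyn \<Rightarrow> 'v monom" where
  "lead_monom lt p =
     (THE u. u \<in> Poly_Mapping.keys p \<and> (\<forall>v\<in>Poly_Mapping.keys p. v = u \<or> lt v u))"

text \<open>A commutative ring is a module over itself via \<open>(*)\<close>; its submodules are the ideals, so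
  \<open>module.span (*) X\<close> is the ideal generated by \<open>X\<close>.\<close>

definition initial_ideal ::
  "('v monom \<Rightarrow> 'v monom \<Rightarrow> bool) \<Rightarrow> ('v, 'k::field) polyn set \<Rightarrow> ('v, 'k) polyn set" where
  "initial_ideal lt J = module.span (*) {monom_poly (lead_monom lt p) |p. p \<in> J \<and> p \<noteq> 0}"

definition min_monom_gens :: "('v, 'k::field) polyn set \<Rightarrow> 'v monom set" where
  "min_monom_gens I =
     {u. monom_poly u \<in> I \<and>
         (\<forall>v r. u = v + r \<longrightarrow> monom_poly v \<in> I \<longrightarrow> v = u)}"

text \<open>The ring \<open>T\<close> is the polynomial ring on the disjoint union \<open>'n + 'm\<close>, where
  \<open>Inl i\<close> indexes \<open>x\<^sub>i\<close> and \<open>Inr j\<close> indexes \<open>y\<^sub>j\<close>.  Every monomial is \<open>u w\<close> with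
  \<open>u\<close> its \<open>x\<close>-part and \<open>w\<close> its \<open>y\<close>-part.\<close>

definition xpart :: "('n + 'm) monom \<Rightarrow> 'n monom" where
  "xpart u = Poly_Mapping.map_key Inl u"

definition ypart :: "('n + 'm) monom \<Rightarrow> 'm monom" where
  "ypart u = Poly_Mapping.map_key Inr u"

definition product_order ::
  "('m monom \<Rightarrow> 'm monom \<Rightarrow> bool) \<Rightarrow> ('n monom \<Rightarrow> 'n monom \<Rightarrow> bool) \<Rightarrow>
   ('n + 'm) monom \<Rightarrow> ('n + 'm) monom \<Rightarrow> bool" where
  "product_order lty ltx u v \<longleftrightarrow>
     lty (ypart u) (ypart v) \<or> ypart u = ypart v \<and> ltx (xpart u) (xpart v)"

definition wt :: "('m::finite \<Rightarrow> nat) \<Rightarrow> 'm monom \<Rightarrow> nat" where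
  "wt d a = (\<Sum>j\<in>UNIV. Poly_Mapping.lookup a j * d j)"

definition weight_order ::
  "('m::finite \<Rightarrow> nat) \<Rightarrow> ('m monom \<Rightarrow> 'm monom \<Rightarrow> bool) \<Rightarrow> 'm monom \<Rightarrow> 'm monom \<Rightarrow> bool" where
  "weight_order d lt a b \<longleftrightarrow> wt d a < wt d b \<or> wt d a = wt d b \<and> lt a b"

definition x_condition ::
  "(('n::finite + 'm::finite) monom \<Rightarrow> ('n + 'm) monom \<Rightarrow> bool) \<Rightarrow>
   ('n + 'm, 'k::field) polyn set \<Rightarrow> bool" where
  "x_condition lt J \<longleftrightarrow> (\<forall>u\<in>min_monom_gens (initial_ideal lt J). mdeg (xpart u) \<le> 1)"


section \<open>Graded modules over the standard graded polynomial ring\<close>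

definition family_sum :: "('i \<Rightarrow> 'b::ab_group_add set) \<Rightarrow> 'b set" where
  "family_sum G = {(\<Sum>i\<in>I. u i) |I u. finite I \<and> (\<forall>i\<in>I. u i \<in> G i)}"

definition is_direct_sum :: "('i \<Rightarrow> 'b::ab_group_add set) \<Rightarrow> 'b set \<Rightarrow> bool" where
  "is_direct_sum G M \<longleftrightarrow>
     (\<forall>i. 0 \<in> G i \<and> (\<forall>u\<in>G i. \<forall>v\<in>G i. u - v \<in> G i)) \<and>
     M = family_sum G \<and>
     (\<forall>I u. finite I \<longrightarrow> (\<forall>i\<in>I. u i \<in> G i) \<longrightarrow> (\<Sum>i\<in>I. u i) = 0 \<longrightarrow> (\<forall>i\<in>I. u i = 0))"

text \<open>\<open>M\<close> is a submodule of the ambient \<open>'b\<close>, on which the polynomial ring acts by \<open>act\<close>;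
  \<open>G t\<close> is the component of \<open>M\<close> of degree \<open>t\<close>.\<close>

definition graded_module ::
  "(('n::finite, 'k::field) polyn \<Rightarrow> 'b::ab_group_add \<Rightarrow> 'b) \<Rightarrow> 'b set \<Rightarrow> (int \<Rightarrow> 'b set) \<Rightarrow> bool" where
  "graded_module act M G \<longleftrightarrow>
     module act \<and> module.subspace act M \<and> is_direct_sum G M \<and>
     (\<forall>s t. \<forall>p\<in>hom_part s. \<forall>u\<in>G t. act p u \<in> G (s + t))"

definition graded_hom ::
  "(('n::finite, 'k::field) polyn \<Rightarrow> 'b::ab_group_add \<Rightarrow> 'b) \<Rightarrow> 'b set \<Rightarrow> (int \<Rightarrow> 'b set) \<Rightarrow>
   (('n, 'k) polyn \<Rightarrow> 'c::ab_group_add \<Rightarrow> 'c) \<Rightarrow> 'c set \<Rightarrow> (int \<Rightarrow> 'c set) \<Rightarrow> ('b \<Rightarrow> 'c) \<Rightarrow> bool" where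
  "graded_hom act M G act' N H h \<longleftrightarrow>
     h ` M \<subseteq> N \<and> (\<forall>t. h ` G t \<subseteq> H t) \<and>
     (\<forall>u\<in>M. \<forall>v\<in>M. h (u + v) = h u + h v) \<and>
     (\<forall>p. \<forall>u\<in>M. h (act p u) = act' p (h u))"

text \<open>A list \<open>a = [a\<^sub>0, \<dots>, a\<^sub>r]\<close> of integers encodes the graded free module
  \<open>S(-a\<^sub>0) \<oplus> \<dots> \<oplus> S(-a\<^sub>r)\<close>, whose elements are coordinate functions
  vanishing from index \<open>length a\<close> on.\<close>

definition free_mod :: "int list \<Rightarrow> (nat \<Rightarrow> ('n::finite, 'k::field) polyn) set" where
  "free_mod a = {v. \<forall>l\<ge>length a. v l = 0}"

definition free_comp :: "int list \<Rightarrow> int \<Rightarrow> (nat \<Rightarrow> ('n::finite, 'k::field) polyn) set" where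
  "free_comp a t = {v \<in> free_mod a. \<forall>l<length a. v l \<in> hom_part (t - a ! l)}"

definition free_act ::
  "('n::finite, 'k::field) polyn \<Rightarrow> (nat \<Rightarrow> ('n, 'k) polyn) \<Rightarrow> (nat \<Rightarrow> ('n, 'k) polyn)" where
  "free_act p v = (\<lambda>l. p * v l)"

text \<open>\<open>\<dots> \<rightarrow> F\<^sub>2 \<rightarrow> F\<^sub>1 \<rightarrow> F\<^sub>0 \<rightarrow> M \<rightarrow> 0\<close> exact, where \<open>F\<^sub>i\<close> is encoded by \<open>a i\<close>, the map
  \<open>F\<^sub>0 \<rightarrow> M\<close> is \<open>e\<close> and \<open>F\<^sub>i\<^sub>+\<^sub>1 \<rightarrow> F\<^sub>i\<close> is \<open>D i\<close>.\<close>

definition graded_free_resolution ::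
  "(('n::finite, 'k::field) polyn \<Rightarrow> 'b::ab_group_add \<Rightarrow> 'b) \<Rightarrow> 'b set \<Rightarrow> (int \<Rightarrow> 'b set) \<Rightarrow>
   (nat \<Rightarrow> int list) \<Rightarrow> ((nat \<Rightarrow> ('n, 'k) polyn) \<Rightarrow> 'b) \<Rightarrow>
   (nat \<Rightarrow> (nat \<Rightarrow> ('n, 'k) polyn) \<Rightarrow> (nat \<Rightarrow> ('n, 'k) polyn)) \<Rightarrow> bool" where
  "graded_free_resolution act M G a e D \<longleftrightarrow>
     graded_hom free_act (free_mod (a 0)) (free_comp (a 0)) act M G e \<and>
     (\<forall>i. graded_hom free_act (free_mod (a (Suc i))) (free_comp (a (Suc i)))
            free_act (free_mod (a i)) (free_comp (a i)) (D i)) \<and>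
     e ` free_mod (a 0) = M \<and>
     {v \<in> free_mod (a 0). e v = 0} = D 0 ` free_mod (a 1) \<and>
     (\<forall>i. {v \<in> free_mod (a (Suc i)). D i v = 0} = D (Suc i) ` free_mod (a (Suc (Suc i))))"

text \<open>Minimality: the image of \<open>F\<^sub>i\<^sub>+\<^sub>1\<close> lies in the product of the ideal generated by the variables
  with \<open>F\<^sub>i\<close>.\<close>

definition minimal_differentials ::
  "(nat \<Rightarrow> int list) \<Rightarrow>
   (nat \<Rightarrow> (nat \<Rightarrow> ('n::finite, 'k::field) polyn) \<Rightarrow> (nat \<Rightarrow> ('n, 'k) polyn)) \<Rightarrow> bool" where
  "minimal_differentials a D \<longleftrightarrow>
     (\<forall>i. \<forall>v\<in>free_mod (a (Suc i)). \<forall>l. D i v l \<in> module.span (*) (range Var))"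

text \<open>The minimal graded free resolution is unique up to isomorphism, so asking for one with
  \<open>F\<^sub>i = S(-k-i)\<^sup>b\<close> for all \<open>i\<close> is the same as asking it of every one.  For \<open>M = 0\<close> all the
  lists can be empty.\<close>

definition has_linear_resolution ::
  "(('n::finite, 'k::field) polyn \<Rightarrow> 'b::ab_group_add \<Rightarrow> 'b) \<Rightarrow> 'b set \<Rightarrow> (int \<Rightarrow> 'b set) \<Rightarrow> bool" where
  "has_linear_resolution act M G \<longleftrightarrow>
     (\<exists>k a e D. graded_free_resolution act M G a e D \<and> minimal_differentials a D \<and>
        (\<forall>i. set (a i) \<subseteq> {k + int i}))"

definition componentwise_linear ::
  "(('n::finite, 'k::field) polyn \<Rightarrow> 'b::ab_group_add \<Rightarrow> 'b) \<Rightarrow> 'b set \<Rightarrow> (int \<Rightarrow> 'b set) \<Rightarrow> bool" where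
  "componentwise_linear act M G \<longleftrightarrow>
     graded_module act M G \<and>
     (\<forall>k. has_linear_resolution act (module.span act (G k)) (\<lambda>t. module.span act (G k) \<inter> G t))"


section \<open>Bigraded algebras\<close>

text \<open>The second degree is the power of \<open>A\<^sub>1\<close>, hence a natural number.\<close>

locale bigraded_algebra = vector_space scale
  for scale :: "'k::field \<Rightarrow> 'a::comm_ring_1 \<Rightarrow> 'a" +
  fixes A :: "int \<Rightarrow> nat \<Rightarrow> 'a set"
  assumes scale_mult: "scale c (a * b) = scale c a * b"
    and subspace_A: "module.subspace scale (A i j)"
    and direct_sum_A: "is_direct_sum (\<lambda>(i, j). A i j) UNIV"
    and mult_A: "a \<in> A i j \<Longrightarrow> b \<in> A i' j' \<Longrightarrow> a * b \<in> A (i + i') (j + j')"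
    and A_0_0: "A 0 0 = range (\<lambda>c. scale c 1)"

definition bicomp :: "(int \<Rightarrow> nat \<Rightarrow> 'a::ab_group_add set) \<Rightarrow> nat \<Rightarrow> 'a set" where
  "bicomp A j = family_sum (\<lambda>i. A i j)"

text \<open>The identification of \<open>S\<close> with \<open>A\<^sub>0\<close> is the map \<open>\<iota>\<close>; it makes \<open>A\<close> an \<open>S\<close>-module.
  Conditions (i), (ii), (iii) are the assumptions \<open>iota_*\<close>, the next two, and the last one.\<close>

definition S_act :: "(('n, 'k::field) polyn \<Rightarrow> 'a::comm_ring_1) \<Rightarrow> ('n, 'k) polyn \<Rightarrow> 'a \<Rightarrow> 'a" where
  "S_act \<iota> p a = \<iota> p * a"

locale bigraded_algebra_over_poly = bigraded_algebra scale A
  for scale :: "'k::field \<Rightarrow> 'a::comm_ring_1 \<Rightarrow> 'a" and A :: "int \<Rightarrow> nat \<Rightarrow> 'a set" +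
  fixes \<iota> :: "('n::finite, 'k) polyn \<Rightarrow> 'a"
  assumes iota_hom: "poly_alg_hom scale \<iota>"
    and iota_inj: "inj \<iota>"
    and iota_graded: "\<iota> ` hom_part i = A i 0"
    and A_1_finite: "\<exists>B. finite B \<and> bicomp A 1 = module.span (S_act \<iota>) B"
    and A_1_nonneg: "i < 0 \<Longrightarrow> A i 1 = {0}"
    and A_power: "j \<ge> 1 \<Longrightarrow>
      bicomp A j = module.span (S_act \<iota>) {(\<Prod>l<j. g l) |g. \<forall>l<j. g l \<in> bicomp A 1}"

end

theory Submission
  imports Defs "HOL-Library.FuncSet"
begin

text \<open>Fix \<open>k \<ge> 1\<close>.  The \<open>S\<close>-module \<open>A\<^sub>k\<close> is generated by the images \<open>g\<^sub>w\<close> of the monomials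
  \<open>w\<close> of degree \<open>k\<close> in the variables \<open>y\<close>; list them in increasing order for \<open><'\<close>.  A polynomial
  \<open>p\<close> multiplies \<open>g\<^sub>w\<close> into the submodule spanned by the earlier generators exactly if \<open>p w\<close> can
  be completed by terms with smaller \<open>y\<close>-part to an element of \<open>J\<close>.  The product order
  compares \<open>y\<close>-parts first, so the leading monomials of such \<open>p\<close> are the \<open>u\<close> with
  \<open>u w \<in> in(J)\<close>.  By the \<open>x\<close>-condition they are the multiples of some monomials of degree at
  most 1, and as the colon ideal of \<open>g\<^sub>w\<close> is homogeneous, it is the unit ideal or generated by
  linear forms (\<open>linear_ideal_if_linear_leads\<close>, \<open>colon_linear\<close>).  Hence \<open>A\<^sub>k\<close> has linear
  quotients, and since \<open><'\<close> compares weights first, the degrees of the generators do not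
  decrease along the list.

  Such a module is componentwise linear.  The proof uses no Koszul complex and no mapping cone.
  It works with the class \<open>lin_quot\<close> of modules that are built up by adjoining generators of one
  degree with colon ideals generated by linear forms, and shows that the class is closed under
  the operations that matter.  The first syzygies of such a module again have linear quotients,
  one degree higher (\<open>syzygies_lin_quot\<close>), and iterating this yields a linear resolution.  So do
  the multiples by the maximal ideal (\<open>lin_quot_maximal_multiple\<close>), which lets one pass from the
  component of degree \<open>j\<close> to that of degree \<open>j + 1\<close> and adjoin the generators of that degree
  (\<open>lin_quot_components_insert\<close>).  Both closure properties rest on one fact about ideals generated
  by linear forms: they are prime (\<open>linear_forms_span_prime\<close>), so dividing such an ideal by a
  polynomial gives the same ideal or the whole ring.\<close>

section \<open>Polynomials and their homogeneous components\<close>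

abbreviation "coeff \<equiv> Poly_Mapping.lookup"
abbreviation "supp \<equiv> Poly_Mapping.keys"

lemma poly_eq_sum_terms: "p = (\<Sum>u\<in>supp p. Poly_Mapping.single u (coeff p u))"
proof (rule poly_mapping_eqI)
  fix k
  have "coeff (\<Sum>u\<in>supp p. Poly_Mapping.single u (coeff p u)) k
      = (\<Sum>u\<in>supp p. if u = k then coeff p k else 0)"
    unfolding lookup_sum by (intro sum.cong) (auto simp: lookup_single when_def)
  then show "coeff p k = coeff (\<Sum>u\<in>supp p. Poly_Mapping.single u (coeff p u)) k"
    by (auto simp: in_keys_iff)
qed

lemma poly_mapping_add_induct [case_names single add]:
  fixes p :: "'a \<Rightarrow>\<^sub>0 'b::comm_monoid_add"
  assumes single: "\<And>u c. P (Poly_Mapping.single u c)" and add: "\<And>p q. P p \<Longrightarrow> P q \<Longrightarrow> P (p + q)"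
  shows "P p"
proof -
  have "P (\<Sum>u\<in>U. Poly_Mapping.single u (coeff p u))" if "finite U" for U
    using that
  proof (induction U rule: finite_induct)
    case empty
    then show ?case using single[of undefined 0] by simp
  qed (use single add in auto)
  then show ?thesis
    using poly_eq_sum_terms[of p] by (metis finite_keys)
qed

lemma monom_poly_add: "monom_poly (u + v) = (monom_poly u * monom_poly v :: ('v, 'k::field) polyn)"
  by (simp add: monom_poly_def mult_single)

lemma monom_poly_0: "monom_poly 0 = (1 :: ('v, 'k::field) polyn)"
  by (simp add: monom_poly_def)

lemma single_eq_Const_monom:
  "Poly_Mapping.single u c = (Const c * monom_poly u :: ('v, 'k::field) polyn)"
  by (simp add: monom_poly_def Const_def mult_single)

lemma poly_alg_induct [case_names const var add mult]:
  fixes p :: "('v, 'k::field) polyn"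
  assumes const: "\<And>c. P (Const c)" and var: "\<And>v. P (Var v)"
    and add: "\<And>p q. P p \<Longrightarrow> P q \<Longrightarrow> P (p + q)" and mult: "\<And>p q. P p \<Longrightarrow> P q \<Longrightarrow> P (p * q)"
  shows "P p"
proof (induction p rule: poly_mapping_add_induct)
  case (single u c)
  have one: "P 1"
    using const[of 1] by (simp add: Const_def)
  have "P (monom_poly u)"
  proof (induction u rule: poly_mapping_add_induct)
    case (single v n)
    show ?case
    proof (induction n)
      case 0
      then show ?case using one by (simp add: monom_poly_0)
    next
      case (Suc n)
      have "Poly_Mapping.single v (Suc n) = mvar v + Poly_Mapping.single v n"
        by (simp add: mvar_def single_add[symmetric])
      then show ?case
        using Suc mult var[of v] by (simp add: monom_poly_add Var_def)
    qed
  qed (simp add: monom_poly_add mult)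
  then show ?case
    by (simp add: single_eq_Const_monom mult const)
qed (rule add)

lemma coeff_Const_mult: "coeff (Const c * p) u = c * coeff p u"
  unfolding Const_def mult_map_scale_conv_mult[symmetric]
  by (simp add: map.rep_eq when_def)

lemma Const_add: "Const (a + b) = Const a + Const b"
  by (simp add: Const_def single_add)

lemma Const_mult: "Const (a * b) = Const a * Const b"
  by (simp add: Const_def mult_single)

lemma Const_0 [simp]: "Const 0 = 0" and Const_1 [simp]: "Const 1 = 1"
  by (simp_all add: Const_def)

lemma mdeg_add [simp]: "mdeg (u + v) = mdeg u + mdeg v"
  by (simp add: mdeg_def lookup_add sum.distrib)

lemma mdeg_0 [simp]: "mdeg 0 = 0"
  by (simp add: mdeg_def)

lemma mdeg_mvar [simp]: "mdeg (mvar v) = 1"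
  by (simp add: mdeg_def mvar_def lookup_single when_def)

lemma mdeg_eq_0_iff [simp]: "mdeg u = 0 \<longleftrightarrow> u = 0"
  by (auto simp: mdeg_def intro: poly_mapping_eqI)

lemma monom_split_var:
  fixes u :: "'v::finite monom"
  assumes "u \<noteq> 0"
  obtains v u' where "u = mvar v + u'"
proof -
  obtain v where v: "coeff u v \<noteq> 0"
    using assms poly_mapping_eqI[of u 0] by auto
  have "u = mvar v + (u - mvar v)"
    by (rule poly_mapping_eqI)
       (use v in \<open>auto simp: lookup_add lookup_minus mvar_def lookup_single when_def\<close>)
  then show thesis by (rule that)
qed

lemma monom_split_degree:
  fixes u :: "'v::finite monom"
  assumes "s \<le> mdeg u"
  obtains u1 u2 where "u = u1 + u2" "mdeg u1 = s"
proof -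
  have "\<exists>u1 u2. u = u1 + u2 \<and> mdeg u1 = s"
    using assms
  proof (induction s)
    case 0
    have "u = 0 + u \<and> mdeg (0 :: 'v monom) = 0" by simp
    then show ?case by blast
  next
    case (Suc s)
    then obtain u1 u2 where u: "u = u1 + u2" "mdeg u1 = s" by auto
    with Suc.prems have "u2 \<noteq> 0" by auto
    then obtain v u3 where "u2 = mvar v + u3" by (rule monom_split_var)
    with u have "u = (u1 + mvar v) + u3 \<and> mdeg (u1 + mvar v) = Suc s"
      by (simp add: add.assoc)
    then show ?case by blast
  qed
  then show thesis using that by blast
qed

lemma mdeg_1_cases:
  fixes u :: "'v::finite monom"
  assumes "mdeg u = 1"
  obtains v where "u = mvar v"
proof -
  have "u \<noteq> 0" using assms by auto
  then obtain v u' where "u = mvar v + u'" by (rule monom_split_var)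
  with assms have "u = mvar v" by simp
  then show thesis by (rule that)
qed

lemma coeff_le_mdeg: "coeff u v \<le> mdeg u"
  unfolding mdeg_def by (rule member_le_sum[of v UNIV "coeff u"]) simp_all

lemma finite_monoms_of_degree: "finite {u :: 'v::finite monom. mdeg u = t}"
proof -
  have "coeff u \<in> PiE (UNIV :: 'v set) (\<lambda>_. {0..t})" if "mdeg u = t" for u :: "'v monom"
  proof (rule PiE_I)
    show "coeff u v \<in> {0..t}" for v
      using coeff_le_mdeg[of u v] that by simp
  qed simp
  then have "coeff ` {u :: 'v monom. mdeg u = t} \<subseteq> PiE (UNIV :: 'v set) (\<lambda>_. {0..t})"
    by blast
  moreover have "finite (PiE (UNIV :: 'v set) (\<lambda>_. {0..t}))"
    by (rule finite_PiE) simp_all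
  ultimately have "finite (coeff ` {u :: 'v monom. mdeg u = t})"
    by (rule finite_subset)
  then show ?thesis
    by (rule finite_imageD) (rule inj_onI, rule poly_mapping_eqI, simp)
qed

lemma hom_part_0 [simp]: "0 \<in> hom_part t"
  by (simp add: hom_part_def)

lemma hom_part_add: "p \<in> hom_part t \<Longrightarrow> q \<in> hom_part t \<Longrightarrow> p + q \<in> hom_part t"
  using keys_add[of p q] by (auto simp: hom_part_def)

lemma hom_part_uminus: "p \<in> hom_part t \<Longrightarrow> - p \<in> hom_part t"
  by (auto simp: hom_part_def in_keys_iff)

lemma hom_part_diff: "p \<in> hom_part t \<Longrightarrow> q \<in> hom_part t \<Longrightarrow> p - q \<in> hom_part t"
  using hom_part_add[OF _ hom_part_uminus, of p t q] by simp

lemma hom_part_sum: "(\<And>i. i \<in> I \<Longrightarrow> f i \<in> hom_part t) \<Longrightarrow> sum f I \<in> hom_part t"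
  by (induction I rule: infinite_finite_induct) (auto simp: hom_part_add)

lemma hom_part_mult:
  assumes "p \<in> hom_part s" "q \<in> hom_part t"
  shows "p * q \<in> hom_part (s + t)"
proof -
  have "int (mdeg w) = s + t" if w: "w \<in> supp (p * q)" for w
  proof -
    obtain a b where "w = a + b" "a \<in> supp p" "b \<in> supp q"
      using subsetD[OF keys_mult w] by blast
    with assms show ?thesis by (auto simp: hom_part_def)
  qed
  then show ?thesis by (simp add: hom_part_def)
qed

lemma hom_part_single: "int (mdeg u) = t \<Longrightarrow> Poly_Mapping.single u c \<in> hom_part t"
  by (simp add: hom_part_def)

lemma monom_poly_hom_part: "int (mdeg u) = t \<Longrightarrow> monom_poly u \<in> hom_part t"
  by (simp add: monom_poly_def hom_part_single)

lemma Var_hom_part [simp]: "Var v \<in> hom_part 1"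
  by (simp add: Var_def monom_poly_hom_part)

lemma Const_hom_part [simp]: "Const c \<in> hom_part 0"
  by (simp add: Const_def hom_part_single)

lemma hom_part_Const_mult: "p \<in> hom_part t \<Longrightarrow> Const c * p \<in> hom_part t"
  using hom_part_mult[OF Const_hom_part, of p t c] by simp

lemma hom_part_negative: "p \<in> hom_part t \<Longrightarrow> t < 0 \<Longrightarrow> p = 0"
  by (rule poly_mapping_eqI) (force simp: hom_part_def in_keys_iff)

definition hcomp :: "int \<Rightarrow> ('v::finite, 'k::field) polyn \<Rightarrow> ('v, 'k) polyn" where
  "hcomp t p = (\<Sum>u\<in>{u\<in>supp p. int (mdeg u) = t}. Poly_Mapping.single u (coeff p u))"

lemma coeff_hcomp: "coeff (hcomp t p) u = (if int (mdeg u) = t then coeff p u else 0)"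
proof -
  have "coeff (hcomp t p) u
      = (\<Sum>w\<in>{w\<in>supp p. int (mdeg w) = t}. if w = u then coeff p u else 0)"
    unfolding hcomp_def lookup_sum by (intro sum.cong) (auto simp: lookup_single when_def)
  then show ?thesis
    by (auto simp: in_keys_iff)
qed

lemma hcomp_hom_part [simp]: "hcomp t p \<in> hom_part t"
  by (auto simp: hom_part_def in_keys_iff coeff_hcomp split: if_split_asm)

lemma hcomp_self: "p \<in> hom_part t \<Longrightarrow> hcomp t p = p"
  by (rule poly_mapping_eqI) (auto simp: coeff_hcomp hom_part_def in_keys_iff)

lemma hcomp_eq_0: "\<forall>u\<in>supp p. int (mdeg u) \<noteq> t \<Longrightarrow> hcomp t p = 0"
  by (rule poly_mapping_eqI) (auto simp: coeff_hcomp in_keys_iff)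

lemma poly_eq_sum_hcomp:
  assumes "finite D" "(\<lambda>u. int (mdeg u)) ` supp p \<subseteq> D"
  shows "p = (\<Sum>t\<in>D. hcomp t p)"
proof (rule poly_mapping_eqI)
  fix u
  have "coeff (\<Sum>t\<in>D. hcomp t p) u = (if int (mdeg u) \<in> D then coeff p u else 0)"
    using assms(1) by (simp add: lookup_sum coeff_hcomp)
  also have "\<dots> = coeff p u"
  proof (cases "u \<in> supp p")
    case True
    with assms(2) have "int (mdeg u) \<in> D" by blast
    then show ?thesis by simp
  next
    case False
    then show ?thesis by (simp add: in_keys_iff)
  qed
  finally show "coeff p u = coeff (\<Sum>t\<in>D. hcomp t p) u" by simp
qed

interpretation ideal: module "(*) :: 'a::comm_ring_1 \<Rightarrow> 'a \<Rightarrow> 'a"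
  by unfold_locales (simp_all add: algebra_simps)

(* As a simp rule this would undo mult.assoc, and the two would rewrite each other forever. *)
declare ideal.scale_scale [simp del]

lemma linear_form_eq_sum_vars:
  assumes "l \<in> hom_part 1"
  shows "l = (\<Sum>v\<in>UNIV. Const (coeff l (mvar v)) * (Var v :: ('v::finite, 'k::field) polyn))"
proof (rule poly_mapping_eqI)
  fix u :: "'v monom"
  have inj: "mvar v = mvar w \<longleftrightarrow> v = w" for v w :: 'v
    by (auto simp: mvar_def dest: arg_cong[where f = "\<lambda>m. coeff m v"]
        simp: lookup_single when_def split: if_splits)
  have "coeff (\<Sum>v\<in>UNIV. Const (coeff l (mvar v)) * (Var v :: ('v, 'k) polyn)) u
      = (\<Sum>v\<in>UNIV. if mvar v = u then coeff l (mvar v) else 0)"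
    unfolding lookup_sum coeff_Const_mult
    by (intro sum.cong) (auto simp: Var_def monom_poly_def lookup_single when_def)
  also have "\<dots> = coeff l u"
  proof (cases "mdeg u = 1")
    case True
    then obtain v where "u = mvar v" by (rule mdeg_1_cases)
    then show ?thesis by (simp add: inj)
  next
    case False
    then have "coeff l u = 0"
      using assms by (auto simp: hom_part_def in_keys_iff)
    moreover have "mvar v \<noteq> u" for v
      using False by auto
    ultimately show ?thesis by simp
  qed
  finally show "coeff l u = coeff (\<Sum>v\<in>UNIV. Const (coeff l (mvar v)) * (Var v :: ('v, 'k) polyn)) u"
    by simp
qed

lemma linear_form_in_maximal_ideal:
  assumes "l \<in> hom_part 1"
  shows "l \<in> ideal.span (range Var)"
  using linear_form_eq_sum_vars[OF assms]
  by (metis (no_types, lifting) ideal.span_base ideal.span_scale ideal.span_sum rangeI)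

section \<open>Leading monomials\<close>

lemma monom_poly_nonzero [simp]: "monom_poly u \<noteq> (0 :: ('v, 'k::field) polyn)"
  by (metis monom_poly_def lookup_single_eq lookup_zero one_neq_zero)

lemma finite_has_greatest:
  fixes lt :: "'a \<Rightarrow> 'a \<Rightarrow> bool"
  assumes total: "\<And>u v. u \<noteq> v \<Longrightarrow> lt u v \<or> lt v u" and trans: "\<And>u v w. lt u v \<Longrightarrow> lt v w \<Longrightarrow> lt u w"
    and U: "finite U" "U \<noteq> {}"
  shows "\<exists>u\<in>U. \<forall>v\<in>U. v = u \<or> lt v u"
  using U
proof (induction U rule: finite_ne_induct)
  case (insert x F)
  then obtain u where u: "u \<in> F" "\<forall>v\<in>F. v = u \<or> lt v u" by blast
  consider "x = u" | "lt x u" | "lt u x"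
    using total by blast
  then show ?case
  proof cases
    case 3
    then have "\<forall>v\<in>insert x F. v = x \<or> lt v x"
      using u(2) trans[of _ u x] by auto
    then show ?thesis by blast
  qed (use u in auto)
qed simp

locale monomial_ordering =
  fixes lt :: "'v::finite monom \<Rightarrow> 'v monom \<Rightarrow> bool"
  assumes order: "monomial_order lt"
begin

lemma lt_irrefl: "\<not> lt u u"
  using order by (simp add: monomial_order_def)

lemma lt_trans: "lt u v \<Longrightarrow> lt v w \<Longrightarrow> lt u w"
  using order unfolding monomial_order_def by blast

lemma lt_total: "u \<noteq> v \<Longrightarrow> lt u v \<or> lt v u"
  using order by (simp add: monomial_order_def)

lemma lt_zero: "u \<noteq> 0 \<Longrightarrow> lt 0 u"
  using order by (simp add: monomial_order_def)

lemma lt_add_right: "lt u v \<Longrightarrow> lt (u + w) (v + w)"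
  using order by (simp add: monomial_order_def)

lemma lt_add_left: "lt u v \<Longrightarrow> lt (w + u) (w + v)"
  using lt_add_right[of u v w] by (simp add: add.commute)

lemma lead_monom_eqI:
  assumes "u \<in> supp p" "\<And>v. v \<in> supp p \<Longrightarrow> v = u \<or> lt v u"
  shows "lead_monom lt p = u"
  unfolding lead_monom_def
proof (rule the_equality)
  show "u' = u" if "u' \<in> supp p \<and> (\<forall>v\<in>supp p. v = u' \<or> lt v u')" for u'
    using that assms(1) assms(2)[of u'] lt_trans[of u u' u] lt_irrefl by auto
qed (use assms in auto)

lemma
  assumes "p \<noteq> 0"
  shows lead_monom_in_supp: "lead_monom lt p \<in> supp p"
    and lead_monom_greatest: "v \<in> supp p \<Longrightarrow> v = lead_monom lt p \<or> lt v (lead_monom lt p)"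
proof -
  have "supp p \<noteq> {}" using assms by simp
  then have "\<exists>u\<in>supp p. \<forall>v\<in>supp p. v = u \<or> lt v u"
    by (intro finite_has_greatest) (simp_all add: lt_total, erule (1) lt_trans)
  then obtain u where "u \<in> supp p" "\<forall>v\<in>supp p. v = u \<or> lt v u"
    by blast
  moreover from this have "lead_monom lt p = u"
    by (intro lead_monom_eqI) auto
  ultimately show "lead_monom lt p \<in> supp p"
    and "v \<in> supp p \<Longrightarrow> v = lead_monom lt p \<or> lt v (lead_monom lt p)"
    by auto
qed

text \<open>After splitting off the leading terms of both factors, every other product of terms has a
  monomial strictly below the sum of the two leading monomials.\<close>

lemma coeff_mult_lead:
  assumes "p \<noteq> 0" "q \<noteq> 0"
  shows "coeff (p * q) (lead_monom lt p + lead_monom lt q)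
       = coeff p (lead_monom lt p) * coeff q (lead_monom lt q)"
proof -
  define u v where "u = lead_monom lt p" and "v = lead_monom lt q"
  define p' q' where "p' = p - Poly_Mapping.single u (coeff p u)"
    and "q' = q - Poly_Mapping.single v (coeff q v)"
  have p': "lt a u" if "a \<in> supp p'" for a
    using that lead_monom_greatest[OF assms(1), of a]
    by (auto simp: p'_def u_def in_keys_iff lookup_minus lookup_single when_def split: if_splits)
  have q': "lt b v" if "b \<in> supp q'" for b
    using that lead_monom_greatest[OF assms(2), of b]
    by (auto simp: q'_def v_def in_keys_iff lookup_minus lookup_single when_def split: if_splits)
  have "p * q = (Poly_Mapping.single u (coeff p u) + p') * (Poly_Mapping.single v (coeff q v) + q')"
    by (simp add: p'_def q'_def)
  also have "\<dots> = Poly_Mapping.single (u + v) (coeff p u * coeff q v)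
      + (Poly_Mapping.single u (coeff p u) * q' + p' * q)"
    by (simp add: distrib_left distrib_right mult_single q'_def right_diff_distrib)
  finally have pq: "p * q = \<dots>" .
  have "u + v \<notin> supp (Poly_Mapping.single u (coeff p u) * q')"
  proof
    assume "u + v \<in> supp (Poly_Mapping.single u (coeff p u) * q')"
    then obtain b where "u + v = u + b" "b \<in> supp q'"
      using keys_mult[of "Poly_Mapping.single u (coeff p u)" q'] by (fastforce split: if_splits)
    then show False using q'[of b] lt_irrefl by auto
  qed
  moreover have "u + v \<notin> supp (p' * q)"
  proof
    assume "u + v \<in> supp (p' * q)"
    then obtain a b where ab: "u + v = a + b" "a \<in> supp p'" "b \<in> supp q"
      using keys_mult[of p' q] by blast
    have "lt (a + b) (u + b)" using ab p' lt_add_right by auto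
    moreover have "b = v \<or> lt b v" using ab lead_monom_greatest[OF assms(2)] v_def by auto
    ultimately have "lt (a + b) (u + v)" using lt_trans lt_add_left by metis
    then show False using ab lt_irrefl by auto
  qed
  ultimately show ?thesis
    unfolding u_def[symmetric] v_def[symmetric] pq
    by (simp add: lookup_add in_keys_iff)
qed

lemma no_zero_divisors:
  fixes p q :: "('v, 'k::field) polyn"
  assumes "p * q = 0"
  shows "p = 0 \<or> q = 0"
proof (rule ccontr)
  assume "\<not> (p = 0 \<or> q = 0)"
  then have "coeff (p * q) (lead_monom lt p + lead_monom lt q) \<noteq> 0"
    using coeff_mult_lead[of p q] lead_monom_in_supp[of p] lead_monom_in_supp[of q]
    by (auto simp: in_keys_iff)
  with assms show False by simp
qed

lemma lead_monom_mult:
  assumes "p \<noteq> 0" "q \<noteq> 0"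
  shows "lead_monom lt (p * q) = lead_monom lt p + lead_monom lt q"
proof (rule lead_monom_eqI)
  show "lead_monom lt p + lead_monom lt q \<in> supp (p * q)"
    using coeff_mult_lead[OF assms] lead_monom_in_supp[OF assms(1)] lead_monom_in_supp[OF assms(2)]
    by (simp add: in_keys_iff)
next
  fix w assume "w \<in> supp (p * q)"
  then obtain a b where "w = a + b" "a \<in> supp p" "b \<in> supp q"
    using keys_mult[of p q] by blast
  with lead_monom_greatest[OF assms(1)] lead_monom_greatest[OF assms(2)]
  show "w = lead_monom lt p + lead_monom lt q \<or> lt w (lead_monom lt p + lead_monom lt q)"
    by (metis lt_add_left lt_add_right lt_trans)
qed

lemma lead_monom_single [simp]: "c \<noteq> 0 \<Longrightarrow> lead_monom lt (Poly_Mapping.single u c) = u"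
  by (rule lead_monom_eqI) auto

lemma lead_monom_monom_poly [simp]: "lead_monom lt (monom_poly u :: ('v, 'k::field) polyn) = u"
  by (simp add: monom_poly_def)

lemma monom_poly_mult_nonzero:
  "(p :: ('v, 'k::field) polyn) \<noteq> 0 \<Longrightarrow> monom_poly u * p \<noteq> 0"
  using no_zero_divisors[of "monom_poly u" p] by auto

end

text \<open>It suffices to exhibit one monomial order.  Numbering the variables embeds the
  exponent vectors additively into those indexed by \<open>nat\<close>, which are linearly ordered
  lexicographically.\<close>

lemma no_zero_divisors_poly:
  fixes p q :: "('v::finite, 'k::field) polyn"
  assumes "p * q = 0"
  shows "p = 0 \<or> q = 0"
proof -
  obtain g :: "'v \<Rightarrow> nat" where g: "inj g"
    using finite_imp_inj_to_nat_seg[OF finite_UNIV] by auto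
  define F :: "'v monom \<Rightarrow> nat monom"
    where "F u = (\<Sum>v\<in>UNIV. Poly_Mapping.single (g v) (coeff u v))" for u
  have F_add: "F (u + v) = F u + F v" for u v
    by (simp add: F_def lookup_add single_add sum.distrib)
  have coeff_F: "coeff (F u) (g v) = coeff u v" for u v
  proof -
    have "coeff (F u) (g v) = (\<Sum>w\<in>UNIV. if w = v then coeff u v else 0)"
      unfolding F_def lookup_sum
      by (intro sum.cong) (auto simp: lookup_single when_def dest: injD[OF g])
    then show ?thesis by simp
  qed
  have F_inj: "F u = F v \<Longrightarrow> u = v" for u v
    by (rule poly_mapping_eqI) (metis coeff_F)
  have F_pos: "0 < F u" if "u \<noteq> 0" for u
  proof -
    have "F u \<noteq> 0"
      using F_inj[of u 0] that by (auto simp: F_def)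
    moreover have "\<not> F u < 0"
      by (simp add: less_poly_mapping.rep_eq less_fun_def)
    ultimately show ?thesis by simp
  qed
  have F_0: "F 0 = 0"
    by (simp add: F_def)
  have "F u < F v \<or> F v < F u" if "u \<noteq> v" for u v
    using F_inj[of u v] that by (meson linorder_neqE)
  then interpret monomial_ordering "\<lambda>u v. F u < F v"
    by unfold_locales (auto simp: monomial_order_def F_add F_0 F_pos)
  show ?thesis using assms by (rule no_zero_divisors)
qed

section \<open>Ideals generated by linear forms\<close>

definition monom_subst :: "('v::finite \<Rightarrow> 'a::comm_ring_1) \<Rightarrow> 'v monom \<Rightarrow> 'a" where
  "monom_subst \<sigma> u = (\<Prod>v\<in>UNIV. \<sigma> v ^ coeff u v)"

definition subst :: "('v::finite \<Rightarrow> ('w, 'k::field) polyn) \<Rightarrow> ('v, 'k) polyn \<Rightarrow> ('w, 'k) polyn" where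
  "subst \<sigma> p = (\<Sum>u\<in>supp p. Const (coeff p u) * monom_subst \<sigma> u)"

lemma subst_superset:
  assumes "finite U" "supp p \<subseteq> U"
  shows "subst \<sigma> p = (\<Sum>u\<in>U. Const (coeff p u) * monom_subst \<sigma> u)"
  unfolding subst_def
  by (rule sum.mono_neutral_left) (use assms in \<open>auto simp: in_keys_iff\<close>)

lemma subst_add: "subst \<sigma> (p + q) = subst \<sigma> p + subst \<sigma> q"
proof -
  let ?U = "supp p \<union> supp q"
  have "supp (p + q) \<subseteq> ?U" by (rule keys_add)
  then show ?thesis
    by (simp add: subst_superset[of ?U] lookup_add Const_add distrib_right sum.distrib)
qed

lemma subst_single: "subst \<sigma> (Poly_Mapping.single u c) = Const c * monom_subst \<sigma> u"
  by (simp add: subst_superset[of "{u}"])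

lemma subst_Const [simp]: "subst \<sigma> (Const c) = Const c"
  unfolding Const_def[of c] subst_single by (simp add: monom_subst_def Const_def)

lemma subst_0 [simp]: "subst \<sigma> 0 = 0"
  by (simp add: subst_def)

lemma subst_Var [simp]: "subst \<sigma> (Var v) = \<sigma> v"
proof -
  have "(\<Prod>w\<in>UNIV. \<sigma> w ^ coeff (mvar v) w) = (\<Prod>w\<in>UNIV. if w = v then \<sigma> v else 1)"
    by (intro prod.cong) (auto simp: mvar_def lookup_single when_def)
  then show ?thesis
    by (simp add: Var_def monom_poly_def subst_single monom_subst_def)
qed

lemma subst_mult: "subst \<sigma> (p * q) = subst \<sigma> p * subst \<sigma> q"
proof (induction p rule: poly_mapping_add_induct)
  case (single u c)
  show ?case
  proof (induction q rule: poly_mapping_add_induct)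
    case (single v d)
    have "monom_subst \<sigma> (u + v) = monom_subst \<sigma> u * monom_subst \<sigma> v"
      by (simp add: monom_subst_def lookup_add power_add prod.distrib)
    then show ?case
      by (simp add: mult_single subst_single Const_mult)
  qed (simp add: distrib_left subst_add)
qed (simp add: distrib_right subst_add)

lemma subst_sum: "subst \<sigma> (sum f I) = (\<Sum>i\<in>I. subst \<sigma> (f i))"
  by (induction I rule: infinite_finite_induct) (simp_all add: subst_add)

lemma subst_linear_form:
  assumes "l \<in> hom_part 1" "\<And>v. \<sigma> v \<in> hom_part t"
  shows "subst \<sigma> l \<in> hom_part t"
  by (subst linear_form_eq_sum_vars[OF assms(1)])
     (simp add: subst_sum subst_mult hom_part_sum hom_part_Const_mult assms(2))

lemma subst_cong_mod:
  assumes I: "ideal.subspace I" and "\<And>v. \<sigma> v - Var v \<in> I"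
  shows "subst \<sigma> p - p \<in> I"
proof (induction p rule: poly_alg_induct)
  case (add p q)
  then have "(subst \<sigma> p - p) + (subst \<sigma> q - q) \<in> I"
    by (rule ideal.subspace_add[OF I])
  then show ?case by (simp add: subst_add algebra_simps)
next
  case (mult p q)
  then have "subst \<sigma> q * (subst \<sigma> p - p) + p * (subst \<sigma> q - q) \<in> I"
    by (intro ideal.subspace_add[OF I] ideal.subspace_scale[OF I])
  then show ?case by (simp add: subst_mult algebra_simps)
qed (use assms in \<open>auto simp: ideal.subspace_0\<close>)

text \<open>By induction on the number of generators.  A generator \<open>l \<noteq> 0\<close> can be solved for one of
  its variables.  Substituting the solution kills \<open>l\<close> and changes every polynomial only by a
  multiple of \<open>l\<close>, so membership in the ideal is equivalent to membership of the substituted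
  polynomial in the ideal of the substituted remaining generators, which are again linear forms.
  Once no generator is left, the claim is that the polynomial ring is a domain.\<close>

lemma linear_forms_span_prime:
  fixes ls :: "('v::finite, 'k::field) polyn list"
  assumes "set ls \<subseteq> hom_part 1" "p * q \<in> ideal.span (set ls)"
  shows "p \<in> ideal.span (set ls) \<or> q \<in> ideal.span (set ls)"
  using assms
proof (induction "length ls" arbitrary: ls p q)
  case 0
  then show ?case using no_zero_divisors_poly by auto
next
  case (Suc n)
  then obtain l ls' where ls: "ls = l # ls'" by (cases ls) auto
  show ?case
  proof (cases "l = 0")
    case True
    have "ideal.span (set ls) = ideal.span (set ls')"
      by (auto simp: ls True ideal.span_insert)
    then show ?thesis using Suc.hyps(1)[of ls' p q] Suc.hyps(2) Suc.prems by (simp add: ls)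
  next
    case False
    let ?a = "\<lambda>v. coeff l (mvar v)"
    have l: "l \<in> hom_part 1" using Suc.prems by (simp add: ls)
    have l_eq: "l = (\<Sum>v\<in>UNIV. Const (?a v) * Var v)"
      by (rule linear_form_eq_sum_vars[OF l])
    have "\<exists>b. ?a b \<noteq> 0"
    proof (rule ccontr)
      assume "\<nexists>b. ?a b \<noteq> 0"
      then have "l = 0" by (subst l_eq) simp
      with False show False by simp
    qed
    then obtain b where b: "?a b \<noteq> 0" by blast
    define \<sigma> where "\<sigma> v = (if v = b then Var b - Const (inverse (?a b)) * l else Var v)" for v
    have "subst \<sigma> l = (\<Sum>v\<in>UNIV. Const (?a v) * Var v - (if v = b then l else 0))"
    proof -
      have "Const (?a v) * \<sigma> v = Const (?a v) * Var v - (if v = b then l else 0)" for v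
        using b by (simp add: \<sigma>_def right_diff_distrib mult.assoc[symmetric] Const_mult[symmetric])
      then show ?thesis
        by (subst l_eq) (simp add: subst_sum subst_mult)
    qed
    also have "\<dots> = 0"
      using l_eq by (simp add: sum_subtractf)
    finally have \<sigma>_l: "subst \<sigma> l = 0" .
    let ?ms = "map (subst \<sigma>) ls'"
    let ?I = "ideal.span (set ls)"
    let ?J = "ideal.span (set ?ms)"
    have "\<sigma> v - Var v \<in> ideal.span {l}" for v
    proof -
      have "\<sigma> v - Var v = (if v = b then - Const (inverse (?a b)) else 0) * l"
        by (simp add: \<sigma>_def)
      then show ?thesis
        by (metis ideal.span_base ideal.span_scale singletonI)
    qed
    then have cong_l: "subst \<sigma> p - p \<in> ideal.span {l}" for p
      by (rule subst_cong_mod[OF ideal.subspace_span])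
    moreover have "ideal.span {l} \<subseteq> ?I"
      by (rule ideal.span_mono) (simp add: ls)
    ultimately have cong: "subst \<sigma> p - p \<in> ?I" for p
      by blast
    have forward: "subst \<sigma> p \<in> ?J" if "p \<in> ?I" for p
      using that
    proof (induction rule: ideal.span_induct_alt)
      case (step c x y)
      then have "subst \<sigma> x \<in> ?J"
        by (auto simp: ls \<sigma>_l ideal.span_zero intro: ideal.span_base)
      with step show ?case
        by (simp add: subst_add subst_mult ideal.span_add ideal.span_scale)
    qed (simp add: ideal.span_zero)
    have "?J \<subseteq> ?I"
    proof (rule ideal.span_minimal)
      show "set ?ms \<subseteq> ?I"
      proof clarsimp
        fix m assume "m \<in> set ls'"
        then have "m \<in> ?I" by (simp add: ls ideal.span_base)
        then have "(subst \<sigma> m - m) + m \<in> ?I" by (rule ideal.span_add[OF cong])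
        then show "subst \<sigma> m \<in> ideal.span (set ls)" by simp
      qed
    qed simp
    then have backward: "p \<in> ?I" if "subst \<sigma> p \<in> ?J" for p
    proof -
      have "subst \<sigma> p - (subst \<sigma> p - p) \<in> ?I"
        using that \<open>?J \<subseteq> ?I\<close> by (intro ideal.span_diff cong) auto
      then show ?thesis by simp
    qed
    have "\<sigma> v \<in> hom_part 1" for v
      by (simp add: \<sigma>_def hom_part_diff hom_part_Const_mult l)
    then have "set ?ms \<subseteq> hom_part 1"
      using Suc.prems by (auto simp: ls intro!: subst_linear_form)
    moreover have "subst \<sigma> p * subst \<sigma> q \<in> ?J"
      using forward[OF Suc.prems(2)] by (simp add: subst_mult)
    moreover have "n = length ?ms"
      using Suc.hyps(2) ls by simp
    ultimately have "subst \<sigma> p \<in> ?J \<or> subst \<sigma> q \<in> ?J"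
      using Suc.hyps(1) by blast
    then show ?thesis using backward by blast
  qed
qed

definition linear_ideal :: "('v::finite, 'k::field) polyn set \<Rightarrow> bool" where
  "linear_ideal L \<longleftrightarrow> (\<exists>ls. set ls \<subseteq> hom_part 1 \<and> L = ideal.span (set ls))"

lemma linear_ideal_colon:
  assumes "linear_ideal L"
  shows "{p. p * q \<in> L} = UNIV \<or> linear_ideal {p. p * q \<in> L}"
proof -
  obtain ls where ls: "set ls \<subseteq> hom_part 1" "L = ideal.span (set ls)"
    using assms by (auto simp: linear_ideal_def)
  show ?thesis
  proof (cases "q \<in> L")
    case True
    then show ?thesis by (auto simp: ls ideal.span_scale)
  next
    case False
    have "p * q \<in> L \<longleftrightarrow> p \<in> L" for p
      using linear_forms_span_prime[OF ls(1), of p q] False ideal.span_scale[of p "set ls" q]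
      unfolding ls(2) by (auto simp: mult.commute[of p q])
    then have "{p. p * q \<in> L} = L" by simp
    then show ?thesis using assms by simp
  qed
qed

section \<open>Graded modules and linear quotients\<close>

locale poly_module = module act
  for act :: "('n::finite, 'k::field) polyn \<Rightarrow> 'b::ab_group_add \<Rightarrow> 'b"

locale graded = poly_module act
  for act :: "('n::finite, 'k::field) polyn \<Rightarrow> 'b::ab_group_add \<Rightarrow> 'b" +
  fixes M :: "'b set" and G :: "int \<Rightarrow> 'b set"
  assumes graded: "graded_module act M G"

lemma gradedI:
  assumes "graded_module act M G"
  shows "graded act M G"
proof -
  interpret module act using assms by (simp add: graded_module_def)
  show ?thesis by unfold_locales (rule assms)
qed

context graded
begin

lemma subspace_M: "subspace M"
  using graded by (simp add: graded_module_def)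

lemma direct_sum: "is_direct_sum G M"
  using graded by (simp add: graded_module_def)

lemma G_act: "p \<in> hom_part s \<Longrightarrow> x \<in> G t \<Longrightarrow> act p x \<in> G (s + t)"
  using graded by (simp add: graded_module_def)

lemma G_zero: "0 \<in> G t" and G_diff: "x \<in> G t \<Longrightarrow> y \<in> G t \<Longrightarrow> x - y \<in> G t"
  using direct_sum by (simp_all add: is_direct_sum_def)

lemma G_uminus: "x \<in> G t \<Longrightarrow> - x \<in> G t"
  using G_diff[OF G_zero, of x] by simp

lemma G_add: "x \<in> G t \<Longrightarrow> y \<in> G t \<Longrightarrow> x + y \<in> G t"
  using G_diff[OF _ G_uminus, of x t y] by simp

lemma G_sum: "(\<And>i. i \<in> I \<Longrightarrow> f i \<in> G t) \<Longrightarrow> sum f I \<in> G t"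
  by (induction I rule: infinite_finite_induct) (auto simp: G_zero G_add)

lemma M_eq: "M = family_sum G"
  using direct_sum by (simp add: is_direct_sum_def)

lemma G_subset_M: "G t \<subseteq> M"
proof
  fix x assume "x \<in> G t"
  then have "x = (\<Sum>i\<in>{t}. x) \<and> finite {t} \<and> (\<forall>i\<in>{t}. x \<in> G i)" by simp
  then show "x \<in> M" unfolding M_eq family_sum_def by blast
qed

lemma decomposition_unique:
  assumes "finite I" "\<And>i. i \<in> I \<Longrightarrow> u i \<in> G i" "finite J" "\<And>i. i \<in> J \<Longrightarrow> v i \<in> G i"
    and eq: "sum u I = sum v J"
  shows "(if t \<in> I then u t else 0) = (if t \<in> J then v t else 0)"
proof -
  define w where "w i = (if i \<in> I then u i else 0) - (if i \<in> J then v i else 0)" for i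
  let ?K = "insert t (I \<union> J)"
  have fin: "finite ?K" using assms by simp
  have "(\<Sum>i\<in>?K. if i \<in> I then u i else 0) = sum u I"
    using fin by (intro sum.mono_neutral_cong_right) auto
  moreover have "(\<Sum>i\<in>?K. if i \<in> J then v i else 0) = sum v J"
    using fin by (intro sum.mono_neutral_cong_right) auto
  ultimately have "sum w ?K = 0"
    unfolding w_def sum_subtractf by (simp add: eq)
  moreover have "\<forall>i\<in>?K. w i \<in> G i"
    using assms by (auto simp: w_def G_zero G_diff G_uminus)
  ultimately have "w t = 0"
    using direct_sum fin unfolding is_direct_sum_def by (meson insertI1)
  then show ?thesis by (simp add: w_def)
qed

text \<open>The component of degree \<open>t\<close> of an element of \<open>M\<close>, read off from any decomposition into
  homogeneous elements; outside \<open>M\<close> its value is arbitrary.\<close>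

definition proj :: "int \<Rightarrow> 'b \<Rightarrow> 'b" where
  "proj t x = (THE y. \<exists>I u. finite I \<and> (\<forall>i\<in>I. u i \<in> G i) \<and> x = sum u I \<and>
     y = (if t \<in> I then u t else 0))"

lemma proj_sum_eq:
  assumes "finite I" "\<And>i. i \<in> I \<Longrightarrow> u i \<in> G i"
  shows "proj t (sum u I) = (if t \<in> I then u t else 0)"
  unfolding proj_def
proof (rule the_equality)
  show "\<exists>J v. finite J \<and> (\<forall>i\<in>J. v i \<in> G i) \<and> sum u I = sum v J \<and>
     (if t \<in> I then u t else 0) = (if t \<in> J then v t else 0)"
    using assms by blast
next
  fix y
  assume "\<exists>J v. finite J \<and> (\<forall>i\<in>J. v i \<in> G i) \<and> sum u I = sum v J \<and> y = (if t \<in> J then v t else 0)"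
  then obtain J v where "finite J" "\<forall>i\<in>J. v i \<in> G i" "sum u I = sum v J"
    and y: "y = (if t \<in> J then v t else 0)" by blast
  then show "y = (if t \<in> I then u t else 0)"
    using decomposition_unique[OF assms, of J v t] by simp
qed

lemma proj_G: "x \<in> G s \<Longrightarrow> proj t x = (if t = s then x else 0)"
  using proj_sum_eq[of "{s}" "\<lambda>_. x" t] by simp

lemma proj_0 [simp]: "proj t 0 = 0"
  using proj_G[OF G_zero[of t], of t] by simp

lemma decomposition:
  assumes "x \<in> M"
  obtains I u where "finite I" "\<And>i. u i \<in> G i" "\<And>i. i \<notin> I \<Longrightarrow> u i = 0" "x = sum u I"
proof -
  from assms obtain I u where "finite I" "\<forall>i\<in>I. u i \<in> G i" "x = sum u I"
    by (auto simp: M_eq family_sum_def)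
  then show thesis
    by (intro that[of I "\<lambda>i. if i \<in> I then u i else 0"]) (auto simp: G_zero)
qed

lemma proj_add:
  assumes "x \<in> M" "y \<in> M"
  shows "proj t (x + y) = proj t x + proj t y"
proof -
  obtain I u where I: "finite I" "\<And>i. u i \<in> G i" "\<And>i. i \<notin> I \<Longrightarrow> u i = 0" "x = sum u I"
    using decomposition[OF assms(1)] by metis
  obtain J v where J: "finite J" "\<And>i. v i \<in> G i" "\<And>i. i \<notin> J \<Longrightarrow> v i = 0" "y = sum v J"
    using decomposition[OF assms(2)] by metis
  have x: "x = sum u (I \<union> J)"
    unfolding I(4) by (rule sum.mono_neutral_left) (use I J in auto)
  have y: "y = sum v (I \<union> J)"
    unfolding J(4) by (rule sum.mono_neutral_left) (use I J in auto)
  have "x + y = (\<Sum>i\<in>I\<union>J. u i + v i)"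
    by (simp add: x y sum.distrib)
  then have "proj t (x + y) = (if t \<in> I \<union> J then u t + v t else 0)"
    using proj_sum_eq[of "I \<union> J" "\<lambda>i. u i + v i" t] I J by (simp add: G_add)
  moreover have "proj t x = (if t \<in> I \<union> J then u t else 0)"
    unfolding x by (rule proj_sum_eq) (use I J in auto)
  moreover have "proj t y = (if t \<in> I \<union> J then v t else 0)"
    unfolding y by (rule proj_sum_eq) (use I J in auto)
  ultimately show ?thesis by simp
qed

lemma proj_sum:
  assumes "\<And>i. i \<in> I \<Longrightarrow> f i \<in> M"
  shows "proj t (sum f I) = (\<Sum>i\<in>I. proj t (f i))"
  using assms
  by (induction I rule: infinite_finite_induct) (simp_all add: proj_add subspace_sum[OF subspace_M])

lemma proj_act:
  assumes "h \<in> G e"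
  shows "proj t (act p h) = act (hcomp (t - e) p) h"
proof -
  define D where "D = (\<lambda>u. int (mdeg u)) ` supp p"
  have "act p h = act (\<Sum>s\<in>D. hcomp s p) h"
    using poly_eq_sum_hcomp[of D p] by (simp add: D_def)
  also have "\<dots> = (\<Sum>s\<in>D. act (hcomp s p) h)"
    by (rule scale_sum_left)
  also have "\<dots> = (\<Sum>i\<in>(\<lambda>s. s + e) ` D. act (hcomp (i - e) p) h)"
    by (simp add: sum.reindex)
  also have "proj t \<dots> = (if t \<in> (\<lambda>s. s + e) ` D then act (hcomp (t - e) p) h else 0)"
  proof (rule proj_sum_eq)
    show "act (hcomp (i - e) p) h \<in> G i" for i
      using G_act[OF hcomp_hom_part assms, of "i - e" p] by simp
  qed (simp add: D_def)
  also have "\<dots> = act (hcomp (t - e) p) h"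
  proof (cases "t \<in> (\<lambda>s. s + e) ` D")
    case False
    then have "hcomp (t - e) p = 0"
      by (intro hcomp_eq_0) (force simp: D_def)
    then show ?thesis by simp
  qed simp
  finally show ?thesis .
qed

text \<open>Taking the component of degree \<open>t\<close> of a combination of homogeneous generators replaces each
  coefficient by its component of the complementary degree.  Claims about components of elements
  of a span thus reduce to single generators.\<close>

lemma proj_span:
  assumes x: "x \<in> span H" and N: "subspace N"
    and H: "\<And>h. h \<in> H \<Longrightarrow> \<exists>e. h \<in> G e \<and> (\<forall>p. act (hcomp (t - e) p) h \<in> N)"
  shows "proj t x \<in> N"
proof -
  have "x \<in> M \<and> proj t x \<in> N"
    using x
  proof (induction rule: span_induct_alt)
    case base
    then show ?case using N subspace_M by (simp add: subspace_0)
  next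
    case (step p h y)
    obtain e where h: "h \<in> G e" "act (hcomp (t - e) p) h \<in> N" using H[OF step(1)] by blast
    have M: "act p h \<in> M" "y \<in> M"
      using h G_subset_M subspace_scale[OF subspace_M] step by blast+
    have "proj t (act p h + y) = act (hcomp (t - e) p) h + proj t y"
      using M by (simp add: proj_add proj_act[OF h(1)])
    also have "\<dots> \<in> N"
      using step h by (intro subspace_add[OF N]) auto
    finally show ?case
      using M subspace_add[OF subspace_M] by blast
  qed
  then show ?thesis ..
qed

end

subsection \<open>Linear quotients\<close>

text \<open>The set \<open>X\<close> contains the admissible generators; typically it is the component of one degree.
  The unit ideal is not generated by linear forms, so no generator is superfluous.  This is what
  makes the resolutions below minimal.\<close>

inductive lin_quot ::
  "(('n::finite, 'k::field) polyn \<Rightarrow> 'b::ab_group_add \<Rightarrow> 'b) \<Rightarrow> 'b set \<Rightarrow> 'b set \<Rightarrow> bool"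
  for act X where
  zero: "lin_quot act X {0}"
| step: "lin_quot act X N \<Longrightarrow> h \<in> X \<Longrightarrow> linear_ideal {p. act p h \<in> N} \<Longrightarrow>
    lin_quot act X (module.span act (insert h N))"

context poly_module
begin

lemma lin_quot_subspace: "lin_quot act X N \<Longrightarrow> subspace N"
  by (induction rule: lin_quot.induct) auto

lemma lin_quot_mono:
  "lin_quot act X N \<Longrightarrow> N \<inter> X \<subseteq> X' \<Longrightarrow> lin_quot act X' N"
proof (induction rule: lin_quot.induct)
  case (step N h)
  have "insert h N \<subseteq> span (insert h N)"
    by (rule span_superset)
  with step show ?case by (intro lin_quot.step) auto
qed (rule lin_quot.zero)

lemma lin_quot_span: "lin_quot act X N \<Longrightarrow> N = span (N \<inter> X)"
proof (induction rule: lin_quot.induct)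
  case zero
  have "span ({0} \<inter> X) \<subseteq> {0}"
    by (rule span_minimal) auto
  then show ?case using span_zero[of "{0} \<inter> X"] by auto
next
  case (step N h)
  let ?N = "span (insert h N)"
  have "insert h N \<subseteq> span (?N \<inter> X)"
  proof -
    have "N \<inter> X \<subseteq> ?N \<inter> X" using span_superset[of "insert h N"] by auto
    then have "N \<subseteq> span (?N \<inter> X)" using step.IH span_mono by metis
    moreover have "h \<in> ?N \<inter> X" using step.hyps span_base by auto
    then have "h \<in> span (?N \<inter> X)" by (rule span_base)
    ultimately show ?thesis by simp
  qed
  then have "?N \<subseteq> span (?N \<inter> X)"
    by (rule span_minimal) simp
  moreover have "span (?N \<inter> X) \<subseteq> ?N"
    by (rule span_minimal) auto
  ultimately show ?case by (rule antisym)
qed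

text \<open>A colon ideal equal to the whole ring means that \<open>h\<close> already lies in \<open>N\<close>, and then
  adjoining it changes nothing.\<close>

lemma lin_quot_insert:
  assumes N: "lin_quot act X N" and "h \<in> X"
    and "{p. act p h \<in> N} = UNIV \<or> linear_ideal {p. act p h \<in> N}"
  shows "lin_quot act X (span (insert h N))"
proof (cases "h \<in> N")
  case True
  have "span (insert h N) = N"
    using True lin_quot_subspace[OF N] by (simp add: insert_absorb)
  then show ?thesis using N by simp
next
  case False
  then have "1 \<notin> {p. act p h \<in> N}" by simp
  then have "{p. act p h \<in> N} \<noteq> UNIV" by (metis UNIV_I)
  then show ?thesis using assms by (intro lin_quot.step) auto
qed

lemma lin_quot_list:
  assumes N: "lin_quot act X N" and zs: "set zs \<subseteq> X"
    and colon: "\<And>s. s < length zs \<Longrightarrow>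
      {p. act p (zs ! s) \<in> span (N \<union> set (take s zs))} = UNIV \<or>
      linear_ideal {p. act p (zs ! s) \<in> span (N \<union> set (take s zs))}"
  shows "lin_quot act X (span (N \<union> set zs))"
proof -
  have "lin_quot act X (span (N \<union> set (take s zs)))" if "s \<le> length zs" for s
    using that
  proof (induction s)
    case 0
    have "span (N \<union> set (take 0 zs)) = N" using lin_quot_subspace[OF N] by simp
    then show ?case using N by (simp only:)
  next
    case (Suc s)
    let ?N = "span (N \<union> set (take s zs))"
    have "lin_quot act X (span (insert (zs ! s) ?N))"
      using Suc zs by (intro lin_quot_insert colon) auto
    also have "span (insert (zs ! s) ?N) = span (N \<union> set (take (Suc s) zs))"
      using Suc.prems
      by (auto simp: take_Suc_conv_app_nth span_insert span_span Un_insert_right)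
    finally show ?case .
  qed
  from this[of "length zs"] show ?thesis by simp
qed

end

subsection \<open>Free modules and syzygies\<close>

definition lincomb ::
  "(('n::finite, 'k::field) polyn \<Rightarrow> 'b::ab_group_add \<Rightarrow> 'b) \<Rightarrow> 'b list \<Rightarrow> (nat \<Rightarrow> ('n, 'k) polyn) \<Rightarrow> 'b" where
  "lincomb act hs v = (\<Sum>l<length hs. act (v l) (hs ! l))"

definition syz ::
  "(('n::finite, 'k::field) polyn \<Rightarrow> 'b::ab_group_add \<Rightarrow> 'b) \<Rightarrow> 'b list \<Rightarrow> (nat \<Rightarrow> ('n, 'k) polyn) set" where
  "syz act hs = {v. (\<forall>l\<ge>length hs. v l = 0) \<and> lincomb act hs v = 0}"

abbreviation linear_vectors :: "(nat \<Rightarrow> ('n::finite, 'k::field) polyn) set" where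
  "linear_vectors \<equiv> {v. \<forall>l. v l \<in> hom_part 1}"

lemma sum_fun_apply: "sum f I x = (\<Sum>i\<in>I. f i x)"
  by (induction I rule: infinite_finite_induct) simp_all

interpretation free: poly_module "free_act :: ('n::finite, 'k::field) polyn \<Rightarrow> _"
proof
  fix p q :: "('n, 'k) polyn" and v w :: "nat \<Rightarrow> ('n, 'k) polyn"
  show "free_act p (v + w) = free_act p v + free_act p w"
    by (rule ext) (simp add: free_act_def distrib_left)
  show "free_act (p + q) v = free_act p v + free_act q v"
    by (rule ext) (simp add: free_act_def distrib_right)
  show "free_act p (free_act q v) = free_act (p * q) v"
    by (rule ext) (simp add: free_act_def mult.assoc)
  show "free_act 1 v = v"
    by (rule ext) (simp add: free_act_def)
qed

context poly_module
begin

lemma lincomb_add: "lincomb act hs (u + v) = lincomb act hs u + lincomb act hs v"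
  by (simp add: lincomb_def scale_left_distrib sum.distrib)

lemma lincomb_free_act: "lincomb act hs (free_act p v) = act p (lincomb act hs v)"
  by (simp add: lincomb_def free_act_def scale_sum_right)

lemma lincomb_0 [simp]: "lincomb act hs 0 = 0"
  by (simp add: lincomb_def)

lemma lincomb_append: "lincomb act (hs @ [h]) v = lincomb act hs v + act (v (length hs)) h"
  by (simp add: lincomb_def nth_append)

lemma lincomb_span: "lincomb act hs v \<in> span (set hs)"
  unfolding lincomb_def by (intro span_sum span_scale span_base) auto

lemma span_set_eq_lincomb:
  "span (set hs) = lincomb act hs ` {v. \<forall>l\<ge>length hs. v l = 0}"
proof
  show "span (set hs) \<subseteq> lincomb act hs ` {v. \<forall>l\<ge>length hs. v l = 0}"
  proof
    fix x assume "x \<in> span (set hs)"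
    then show "x \<in> lincomb act hs ` {v. \<forall>l\<ge>length hs. v l = 0}"
    proof (induction rule: span_induct_alt)
      case base
      show ?case by (rule image_eqI[of _ _ "\<lambda>_. 0"]) (simp_all add: lincomb_def)
    next
      case (step c x y)
      then obtain v where v: "\<forall>l\<ge>length hs. v l = 0" "y = lincomb act hs v" by auto
      obtain i where i: "i < length hs" "x = hs ! i" using step by (auto simp: in_set_conv_nth)
      define e where "e l = (if l = i then c else 0)" for l
      have "lincomb act hs e = (\<Sum>l<length hs. if l = i then act c x else 0)"
        unfolding lincomb_def by (intro sum.cong) (auto simp: e_def i)
      also have "\<dots> = act c x" using i by simp
      finally have "act c x + y = lincomb act hs (e + v)"
        by (simp add: lincomb_add v)
      moreover have "\<forall>l\<ge>length hs. (e + v) l = 0"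
        using v i by (simp add: e_def)
      ultimately show ?case by blast
    qed
  qed
qed (auto simp: lincomb_span)

lemma syz_subspace: "free.subspace (syz act hs)"
  by (rule free.subspaceI)
     (simp_all add: syz_def lincomb_add lincomb_free_act, simp_all add: free_act_def)

lemma syz_appendI: "v \<in> syz act hs \<Longrightarrow> v \<in> syz act (hs @ [h])"
  by (simp add: syz_def lincomb_append)

lemma syz_appendD: "v \<in> syz act (hs @ [h]) \<Longrightarrow> v (length hs) = 0 \<Longrightarrow> v \<in> syz act hs"
  by (auto simp: syz_def lincomb_append) (metis le_antisym not_less_eq_eq)

end

context graded
begin

text \<open>In any representation of \<open>x\<close> by the generators, passing to components of degree \<open>k + 1\<close>
  keeps just the linear part of each coefficient.\<close>

lemma linear_coordinates:
  assumes hs: "set hs \<subseteq> G k" and x: "x \<in> span (set hs)" "x \<in> G (k + 1)"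
  obtains v where "v \<in> linear_vectors" "\<forall>l\<ge>length hs. v l = 0" "lincomb act hs v = x"
proof -
  obtain v where v: "\<forall>l\<ge>length hs. v l = 0" "x = lincomb act hs v"
    using x(1) by (auto simp: span_set_eq_lincomb)
  have nth: "hs ! l \<in> G k" if "l < length hs" for l
    using hs that by auto
  have "x = proj (k + 1) x"
    using proj_G[OF x(2)] by simp
  also have "\<dots> = (\<Sum>l<length hs. proj (k + 1) (act (v l) (hs ! l)))"
    unfolding v(2) lincomb_def
  proof (rule proj_sum)
    fix l assume "l \<in> {..<length hs}"
    then have "hs ! l \<in> M" using nth G_subset_M by blast
    then show "act (v l) (hs ! l) \<in> M" by (rule subspace_scale[OF subspace_M])
  qed
  also have "\<dots> = lincomb act hs (\<lambda>l. hcomp 1 (v l))"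
    unfolding lincomb_def by (intro sum.cong) (simp_all add: proj_act[OF nth])
  finally have "lincomb act hs (\<lambda>l. hcomp 1 (v l)) = x" ..
  moreover have "\<forall>l\<ge>length hs. hcomp 1 (v l) = 0"
    using v by (simp add: hcomp_self)
  ultimately show thesis
    by (intro that[of "\<lambda>l. hcomp 1 (v l)"]) auto
qed

text \<open>Adjoin \<open>h\<close>, with colon ideal generated by the linear forms \<open>ls\<close>, to a module with
  generators \<open>hs\<close>.  The last coordinates of the syzygies of \<open>hs @ [h]\<close> form the colon ideal, and the
  syzygies with last coordinate 0 are those of \<open>hs\<close>.  Lifting each \<open>l \<in> set ls\<close> to a syzygy \<open>z l\<close>
  with last coordinate \<open>l\<close> therefore completes the old syzygies to a generating set.  When the
  \<open>z l\<close> are adjoined one by one, the last coordinate identifies each colon ideal with that of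
  \<open>l\<close> over the preceding forms, to which \<open>linear_ideal_colon\<close> applies.\<close>

theorem syzygies_lin_quot:
  assumes "lin_quot act (G k) N"
  shows "\<exists>hs. set hs \<subseteq> G k \<and> span (set hs) = N \<and> lin_quot free_act linear_vectors (syz act hs)"
  using assms
proof (induction rule: lin_quot.induct)
  case zero
  have "syz act [] = {0}"
    by (auto simp: syz_def lincomb_def fun_eq_iff)
  then show ?case
    by (intro exI[of _ "[]"]) (simp add: lin_quot.zero)
next
  case (step N h)
  then obtain hs where hs: "set hs \<subseteq> G k" "span (set hs) = N"
    and syz_hs: "lin_quot free_act linear_vectors (syz act hs)" by blast
  obtain ls where ls: "set ls \<subseteq> hom_part 1" and colon: "{p. act p h \<in> N} = ideal.span (set ls)"
    using step.hyps by (auto simp: linear_ideal_def)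
  let ?q = "length hs" and ?hs = "hs @ [h]"
  have "\<forall>l\<in>set ls. \<exists>v. v \<in> linear_vectors \<and> (\<forall>i\<ge>?q. v i = 0) \<and> lincomb act hs v = act l h"
  proof
    fix l assume l: "l \<in> set ls"
    have "act l h \<in> span (set hs)"
      using colon l ideal.span_base[of l "set ls"] hs by blast
    moreover have "act l h \<in> G (k + 1)"
      using G_act[of l 1 h k] l ls step.hyps by (auto simp: add.commute)
    ultimately show "\<exists>v. v \<in> linear_vectors \<and> (\<forall>i\<ge>?q. v i = 0) \<and> lincomb act hs v = act l h"
      using linear_coordinates[OF hs(1)] by metis
  qed
  from bchoice[OF this] obtain c where c: "\<And>l. l \<in> set ls \<Longrightarrow> c l \<in> linear_vectors \<and> (\<forall>i\<ge>?q. c l i = 0) \<and>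
      lincomb act hs (c l) = act l h" by blast
  \<comment> \<open>\<open>z l\<close> is the relation stating that \<open>act l h\<close> is the combination of \<open>hs\<close> given by \<open>c l\<close>\<close>
  define z where "z l i = (if i = ?q then l else - c l i)" for l i
  have z_q: "z l ?q = l" for l
    by (simp add: z_def)
  have z_linear: "z l \<in> linear_vectors" if "l \<in> set ls" for l
    using c[OF that] ls that by (auto simp: z_def hom_part_uminus)
  have z_syz: "z l \<in> syz act ?hs" if "l \<in> set ls" for l
  proof -
    have "lincomb act hs (z l) = - lincomb act hs (c l)"
      unfolding lincomb_def sum_negf[symmetric] by (intro sum.cong) (auto simp: z_def)
    then show ?thesis
      using c[OF that] by (auto simp: syz_def lincomb_append z_q) (auto simp: z_def)
  qed
  have span_z: "free.span (syz act hs \<union> z ` A) \<subseteq> syz act ?hs" if "A \<subseteq> set ls" for A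
    by (rule free.span_minimal) (use that z_syz syz_appendI in \<open>auto simp: syz_subspace\<close>)
  have coord_in: "x ?q \<in> ideal.span A" if "x \<in> free.span (syz act hs \<union> z ` A)" for x A
    using that
  proof (induction rule: free.span_induct_alt)
    case base
    then show ?case by (simp add: ideal.span_zero)
  next
    case (step p x y)
    have "x ?q \<in> ideal.span A"
      using step by (auto simp: syz_def z_q ideal.span_zero intro: ideal.span_base)
    with step show ?case
      by (simp add: free_act_def ideal.span_add ideal.span_scale)
  qed
  have in_span: "x \<in> free.span (syz act hs \<union> z ` A)"
    if A: "A \<subseteq> set ls" and x: "x \<in> syz act ?hs" "x ?q \<in> ideal.span A" for x A
  proof -
    have "\<exists>y \<in> free.span (z ` A). y ?q = r" if "r \<in> ideal.span A" for r
      using that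
    proof (induction rule: ideal.span_induct_alt)
      case base
      show ?case by (rule bexI[of _ 0]) (simp_all add: free.span_zero)
    next
      case (step p l r)
      then obtain y where y: "y \<in> free.span (z ` A)" "y ?q = r" by blast
      have "free_act p (z l) + y \<in> free.span (z ` A)"
        using step y by (intro free.span_add free.span_scale) (auto intro: free.span_base)
      moreover have "(free_act p (z l) + y) ?q = p * l + r"
        using y by (simp add: free_act_def z_q)
      ultimately show ?case by blast
    qed
    then obtain y where y: "y \<in> free.span (z ` A)" "y ?q = x ?q"
      using x(2) by blast
    have y': "y \<in> free.span (syz act hs \<union> z ` A)"
      using y free.span_mono[of "z ` A" "syz act hs \<union> z ` A"] by auto
    have "x - y \<in> syz act ?hs"
      using x y' span_z[OF A] free.subspace_diff[OF syz_subspace] by blast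
    then have "x - y \<in> syz act hs"
      by (rule syz_appendD) (simp add: y(2))
    then have "x - y \<in> free.span (syz act hs \<union> z ` A)"
      by (simp add: free.span_base)
    then have "(x - y) + y \<in> free.span (syz act hs \<union> z ` A)"
      by (rule free.span_add[OF _ y'])
    then show ?thesis by simp
  qed
  have "lin_quot free_act linear_vectors (free.span (syz act hs \<union> set (map z ls)))"
  proof (rule free.lin_quot_list[OF syz_hs])
    fix s assume s: "s < length (map z ls)"
    let ?A = "set (take s ls)"
    have A: "?A \<subseteq> set ls" by (rule set_take_subset)
    have "free_act p (z (ls ! s)) \<in> free.span (syz act hs \<union> z ` ?A) \<longleftrightarrow> p * ls ! s \<in> ideal.span ?A" for p
    proof
      assume "free_act p (z (ls ! s)) \<in> free.span (syz act hs \<union> z ` ?A)"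
      then show "p * ls ! s \<in> ideal.span ?A"
        using coord_in by (fastforce simp: free_act_def z_q)
    next
      assume "p * ls ! s \<in> ideal.span ?A"
      moreover have "free_act p (z (ls ! s)) \<in> syz act ?hs"
        using s z_syz by (intro free.subspace_scale[OF syz_subspace]) auto
      ultimately show "free_act p (z (ls ! s)) \<in> free.span (syz act hs \<union> z ` ?A)"
        using in_span[OF A] by (simp add: free_act_def z_q)
    qed
    then have eq: "{p. free_act p (map z ls ! s) \<in> free.span (syz act hs \<union> set (take s (map z ls)))}
        = {p. p * ls ! s \<in> ideal.span ?A}"
      using s by (simp add: take_map)
    have "linear_ideal (ideal.span ?A)"
      using ls A unfolding linear_ideal_def by blast
    then show "{p. free_act p (map z ls ! s) \<in> free.span (syz act hs \<union> set (take s (map z ls)))} = UNIV \<or>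
        linear_ideal {p. free_act p (map z ls ! s) \<in> free.span (syz act hs \<union> set (take s (map z ls)))}"
      unfolding eq by (rule linear_ideal_colon)
  qed (use z_linear in auto)
  also have "free.span (syz act hs \<union> set (map z ls)) = syz act ?hs"
  proof
    show "syz act ?hs \<subseteq> free.span (syz act hs \<union> set (map z ls))"
    proof
      fix x assume x: "x \<in> syz act ?hs"
      then have "act (x ?q) h = - lincomb act hs x"
        by (simp add: syz_def lincomb_append eq_neg_iff_add_eq_0 add.commute)
      also have "\<dots> \<in> N"
        using hs lincomb_span span_neg by blast
      finally have "x ?q \<in> ideal.span (set ls)"
        using colon by blast
      with x show "x \<in> free.span (syz act hs \<union> set (map z ls))"
        using in_span[of "set ls" x] by simp
    qed
  qed (use span_z in simp)
  finally have "lin_quot free_act linear_vectors (syz act ?hs)" .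
  moreover have "set ?hs \<subseteq> G k" using hs step.hyps by simp
  moreover have "span (set ?hs) = span (insert h N)"
    using hs by (auto simp: span_insert span_span)
  ultimately show ?case by blast
qed

end

section \<open>Linear resolutions\<close>

lemma hom_part_coeff_eq_0: "p \<in> hom_part t \<Longrightarrow> int (mdeg w) \<noteq> t \<Longrightarrow> coeff p w = 0"
  by (auto simp: hom_part_def in_keys_iff)

lemma free_mod_eq: "free_mod (replicate q c) = {v. \<forall>l\<ge>q. v l = 0}"
  by (simp add: free_mod_def)

lemma free_comp_eq:
  "free_comp (replicate q c) t = {v. (\<forall>l\<ge>q. v l = 0) \<and> (\<forall>l. v l \<in> hom_part (t - c))}"
proof -
  have "v l \<in> hom_part (t - c)"
    if "\<forall>l\<ge>q. v l = 0" "\<forall>l<q. v l \<in> hom_part (t - c)" for v :: "nat \<Rightarrow> ('n::finite, 'k::field) polyn" and l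
    using that by (cases "l < q") auto
  then show ?thesis
    by (auto simp: free_comp_def free_mod_def)
qed

lemma free_direct_sum:
  fixes a :: "int list"
  shows "is_direct_sum (free_comp a) (free_mod a :: (nat \<Rightarrow> ('n::finite, 'k::field) polyn) set)"
  unfolding is_direct_sum_def
proof (intro conjI allI ballI impI)
  fix t and u v :: "nat \<Rightarrow> ('n, 'k) polyn"
  show "0 \<in> (free_comp a t :: (nat \<Rightarrow> ('n, 'k) polyn) set)"
    by (simp add: free_comp_def free_mod_def)
  assume "u \<in> free_comp a t" "v \<in> free_comp a t"
  then show "u - v \<in> free_comp a t"
    by (simp add: free_comp_def free_mod_def hom_part_diff)
next
  show "free_mod a = (family_sum (free_comp a) :: (nat \<Rightarrow> ('n, 'k) polyn) set)"
  proof (intro equalityI subsetI)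
    fix v :: "nat \<Rightarrow> ('n, 'k) polyn" assume v: "v \<in> free_mod a"
    define D where "D = (\<Union>l<length a. (\<lambda>w. int (mdeg w) + a ! l) ` supp (v l))"
    define u where "u t l = (if l < length a then hcomp (t - a ! l) (v l) else 0)" for t l
    have fin: "finite D" by (simp add: D_def)
    have "v l = (\<Sum>t\<in>D. u t l)" for l
    proof (cases "l < length a")
      case True
      have inj: "inj_on (\<lambda>t. t - a ! l) D" by (simp add: inj_on_def)
      have "v l = (\<Sum>s\<in>(\<lambda>t. t - a ! l) ` D. hcomp s (v l))"
        by (rule poly_eq_sum_hcomp) (use True fin in \<open>force simp: D_def\<close>)+
      also have "\<dots> = (\<Sum>t\<in>D. u t l)"
        using True by (simp add: sum.reindex[OF inj] u_def)
      finally show ?thesis .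
    next
      case False
      then show ?thesis using v by (simp add: u_def free_mod_def)
    qed
    then have "v = (\<Sum>t\<in>D. u t)"
      by (simp add: fun_eq_iff sum_fun_apply)
    moreover have "\<forall>t\<in>D. u t \<in> free_comp a t"
      by (auto simp: free_comp_def free_mod_def u_def)
    ultimately show "v \<in> family_sum (free_comp a)"
      unfolding family_sum_def using fin by blast
  next
    fix v :: "nat \<Rightarrow> ('n, 'k) polyn" assume "v \<in> family_sum (free_comp a)"
    then obtain I u where "v = (\<Sum>i\<in>I. u i)" "\<forall>i\<in>I. u i \<in> free_comp a i"
      by (auto simp: family_sum_def)
    then show "v \<in> free_mod a"
      by (auto simp: free_mod_def free_comp_def sum_fun_apply)
  qed
next
  fix I and u :: "int \<Rightarrow> nat \<Rightarrow> ('n, 'k) polyn" and i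
  assume I: "finite I" "\<forall>i\<in>I. u i \<in> free_comp a i" "(\<Sum>i\<in>I. u i) = 0" "i \<in> I"
  have "coeff (u i l) w = 0" for l w
  proof (cases "l < length a \<and> int (mdeg w) = i - a ! l")
    case False
    have "u i \<in> free_comp a i" using I(2,4) by blast
    with False show ?thesis
      by (cases "l < length a") (auto simp: free_comp_def free_mod_def intro: hom_part_coeff_eq_0)
  next
    case True
    have only: "coeff (u j l) w = (if j = i then coeff (u i l) w else 0)" if "j \<in> I" for j
    proof -
      have "u j l \<in> hom_part (j - a ! l)"
        using I(2) that True by (auto simp: free_comp_def)
      then show ?thesis
        using True by (auto intro: hom_part_coeff_eq_0)
    qed
    have "(\<Sum>j\<in>I. coeff (u j l) w) = (\<Sum>j\<in>I. if j = i then coeff (u i l) w else 0)"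
      by (rule sum.cong[OF refl only])
    also have "\<dots> = coeff (u i l) w"
      using I(1,4) by simp
    finally have "(\<Sum>j\<in>I. coeff (u j l) w) = coeff (u i l) w" .
    moreover have "(\<Sum>j\<in>I. coeff (u j l) w) = coeff ((\<Sum>i\<in>I. u i) l) w"
      by (simp add: sum_fun_apply lookup_sum)
    ultimately show ?thesis using I(3) by simp
  qed
  then show "u i = 0"
    by (simp add: fun_eq_iff poly_mapping_eq_iff)
qed

lemma free_graded:
  "graded free_act (free_mod a :: (nat \<Rightarrow> ('n::finite, 'k::field) polyn) set) (free_comp a)"
proof (rule gradedI, unfold graded_module_def, intro conjI allI ballI free_direct_sum)
  show "module (free_act :: ('n, 'k) polyn \<Rightarrow> _)" by unfold_locales
  show "free.subspace (free_mod a :: (nat \<Rightarrow> ('n, 'k) polyn) set)"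
    by (rule free.subspaceI) (simp_all add: free_mod_def free_act_def)
  fix s t :: int and p :: "('n, 'k) polyn" and u :: "nat \<Rightarrow> ('n, 'k) polyn"
  assume "p \<in> hom_part s" "u \<in> free_comp a t"
  then show "free_act p u \<in> free_comp a (s + t)"
    by (auto simp: free_comp_def free_mod_def free_act_def add_diff_eq[symmetric] intro!: hom_part_mult)
qed

context graded
begin

lemma lincomb_graded_hom:
  assumes hs: "set hs \<subseteq> G k" and N: "N = span (set hs)"
  shows "graded_hom free_act (free_mod (replicate (length hs) k)) (free_comp (replicate (length hs) k))
    act N (\<lambda>t. N \<inter> G t) (lincomb act hs)"
proof -
  have "lincomb act hs v \<in> G t" if "v \<in> free_comp (replicate (length hs) k) t" for v t
    unfolding lincomb_def
  proof (rule G_sum)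
    fix l assume "l \<in> {..<length hs}"
    then have "v l \<in> hom_part (t - k)" "hs ! l \<in> G k"
      using that hs by (auto simp: free_comp_eq)
    from G_act[OF this] show "act (v l) (hs ! l) \<in> G t" by simp
  qed
  then show ?thesis
    unfolding graded_hom_def N
    using lincomb_span by (auto simp: lincomb_add lincomb_free_act)
qed

end

text \<open>Put all basis vectors of the free module in degree 0.  Then the vectors of linear forms are
  its component of degree 1, and \<open>syzygies_lin_quot\<close> applies to \<open>Z\<close>.\<close>

lemma next_syzygies:
  assumes Z: "lin_quot free_act linear_vectors Z" "\<forall>v\<in>Z. \<forall>l\<ge>q. v l = 0"
  shows "\<exists>hs. set hs \<subseteq> linear_vectors \<and> free.span (set hs) = Z \<and>
    lin_quot free_act linear_vectors (syz free_act hs)"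
proof -
  interpret F: graded free_act "free_mod (replicate q 0)" "free_comp (replicate q 0)"
    by (rule free_graded)
  have "lin_quot free_act (free_comp (replicate q 0) 1) Z"
    by (rule free.lin_quot_mono[OF Z(1)]) (use Z(2) in \<open>auto simp: free_comp_eq\<close>)
  from F.syzygies_lin_quot[OF this] show ?thesis
    by (fastforce simp: free_comp_eq)
qed

text \<open>The syzygies of a module with linear quotients, the syzygies of those, and so on, all have
  linear quotients with generators whose entries are linear forms.  Mapping the basis vectors to
  these generators gives the differentials, which are minimal as linear forms lie in the ideal
  generated by the variables.\<close>

theorem (in graded) lin_quot_has_linear_resolution:
  assumes "lin_quot act (G k) N"
  shows "has_linear_resolution act N (\<lambda>t. N \<inter> G t)"
proof -
  obtain hs where hs: "set hs \<subseteq> G k" "span (set hs) = N"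
    and Z0: "lin_quot free_act linear_vectors (syz act hs)"
    using syzygies_lin_quot[OF assms] by blast
  let ?P = "\<lambda>gs. set gs \<subseteq> linear_vectors \<and> lin_quot free_act linear_vectors (syz free_act gs)"
  obtain gs0 where gs0: "?P gs0" "free.span (set gs0) = syz act hs"
    using next_syzygies[OF Z0, of "length hs"] by (auto simp: syz_def)
  have "\<exists>f. \<forall>i. (?P (f i) \<and> (i = 0 \<longrightarrow> f i = gs0)) \<and> free.span (set (f (Suc i))) = syz free_act (f i)"
  proof (rule dependent_nat_choice)
    show "\<exists>gs. ?P gs \<and> ((0::nat) = 0 \<longrightarrow> gs = gs0)" using gs0 by blast
  next
    fix gs :: "(nat \<Rightarrow> ('n, 'k) polyn) list" and i :: nat
    assume gs: "?P gs \<and> (i = 0 \<longrightarrow> gs = gs0)"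
    have "\<forall>v\<in>syz free_act gs. \<forall>l\<ge>length gs. v l = 0"
      by (simp add: syz_def)
    from next_syzygies[OF conjunct2[OF conjunct1[OF gs]] this]
    obtain gs' where gs': "set gs' \<subseteq> linear_vectors \<and> free.span (set gs') = syz free_act gs \<and>
      lin_quot free_act linear_vectors (syz free_act gs')" by (rule exE)
    show "\<exists>gs'. (?P gs' \<and> (Suc i = 0 \<longrightarrow> gs' = gs0)) \<and> free.span (set gs') = syz free_act gs"
      by (rule exI[of _ gs']) (use gs' in simp)
  qed
  then obtain f where f_all: "\<forall>i. (?P (f i) \<and> (i = 0 \<longrightarrow> f i = gs0)) \<and>
      free.span (set (f (Suc i))) = syz free_act (f i)" by (rule exE)
  have f: "set (f i) \<subseteq> linear_vectors" "f 0 = gs0"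
    and f_Suc: "free.span (set (f (Suc i))) = syz free_act (f i)" for i
    using f_all by simp_all
  \<comment> \<open>\<open>f i\<close> generates the syzygies of the map out of the free module of rank \<open>q i\<close>; its
    elements are the images of the basis of the next one\<close>
  define q where "q i = (case i of 0 \<Rightarrow> length hs | Suc j \<Rightarrow> length (f j))" for i
  define a where "a i = replicate (q i) (k + int i)" for i
  define D where "D i = lincomb free_act (f i)" for i
  have span_f: "free.span (set (f i)) \<subseteq> free_mod (a i)" for i
    by (cases i) (auto simp: f f_Suc gs0 syz_def a_def q_def free_mod_eq)
  have f_comp: "set (f i) \<subseteq> free_comp (a i) (k + int (Suc i))" for i
  proof
    fix v assume v: "v \<in> set (f i)"
    then have "v \<in> free_mod (a i)" using span_f free.span_base by blast
    with v f(1)[of i] show "v \<in> free_comp (a i) (k + int (Suc i))"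
      by (auto simp: a_def free_comp_eq free_mod_eq)
  qed
  have range_D: "D i ` free_mod (a (Suc i)) = free.span (set (f i))" for i
    by (simp add: D_def free.span_set_eq_lincomb a_def q_def free_mod_eq)
  have hom: "graded_hom free_act (free_mod (a (Suc i))) (free_comp (a (Suc i)))
      free_act (free_mod (a i)) (free_comp (a i)) (D i)" for i
  proof -
    interpret F: graded free_act "free_mod (a i)" "free_comp (a i)"
      by (rule free_graded)
    have "graded_hom free_act (free_mod (a (Suc i))) (free_comp (a (Suc i))) free_act
        (free.span (set (f i))) (\<lambda>t. free.span (set (f i)) \<inter> free_comp (a i) t) (D i)"
      using F.lincomb_graded_hom[OF f_comp refl] by (simp add: a_def q_def D_def)
    then show ?thesis
      using span_f[of i] unfolding graded_hom_def by blast
  qed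
  have "graded_free_resolution act N (\<lambda>t. N \<inter> G t) a (lincomb act hs) D"
    unfolding graded_free_resolution_def
  proof (intro conjI allI hom)
    show "graded_hom free_act (free_mod (a 0)) (free_comp (a 0)) act N (\<lambda>t. N \<inter> G t) (lincomb act hs)"
      using lincomb_graded_hom[OF hs(1) hs(2)[symmetric]] by (simp add: a_def q_def)
    show "lincomb act hs ` free_mod (a 0) = N"
      using hs(2) by (simp add: span_set_eq_lincomb a_def q_def free_mod_eq)
    show "{v \<in> free_mod (a 0). lincomb act hs v = 0} = D 0 ` free_mod (a 1)"
      using range_D[of 0] gs0 f by (auto simp: syz_def a_def q_def free_mod_eq)
    show "{v \<in> free_mod (a (Suc i)). D i v = 0} = D (Suc i) ` free_mod (a (Suc (Suc i)))" for i
      unfolding range_D f_Suc by (auto simp: syz_def a_def q_def free_mod_eq D_def)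
  qed
  moreover have "minimal_differentials a D"
    unfolding minimal_differentials_def
  proof (intro allI ballI)
    fix i v l
    have "v s * (f i ! s) l \<in> ideal.span (range Var)" if "s < length (f i)" for s
    proof -
      have "f i ! s \<in> linear_vectors" using f(1)[of i] nth_mem[OF that] by blast
      then show ?thesis
        by (intro ideal.span_scale linear_form_in_maximal_ideal) simp
    qed
    then show "D i v l \<in> ideal.span (range Var)"
      unfolding D_def lincomb_def sum_fun_apply free_act_def by (intro ideal.span_sum) auto
  qed
  moreover have "\<forall>i. set (a i) \<subseteq> {k + int i}"
    by (auto simp: a_def)
  ultimately show ?thesis
    unfolding has_linear_resolution_def by blast
qed

section \<open>Truncation\<close>

context graded
begin

text \<open>The product of \<open>N\<close> with the ideal generated by the variables.\<close>

definition maximal_multiple :: "'b set \<Rightarrow> 'b set" where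
  "maximal_multiple N = span {act (Var v) x |v x. x \<in> N}"

lemma maximal_multiple_subset: "subspace N \<Longrightarrow> maximal_multiple N \<subseteq> N"
  unfolding maximal_multiple_def by (rule span_minimal) (auto intro: subspace_scale)

lemma maximal_multiple_linear:
  assumes "l \<in> hom_part 1" "x \<in> N"
  shows "act l x \<in> maximal_multiple N"
proof -
  have "act l x = (\<Sum>v\<in>UNIV. act (Const (coeff l (mvar v))) (act (Var v) x))"
    by (subst linear_form_eq_sum_vars[OF assms(1)]) (simp add: scale_sum_left)
  also have "\<dots> \<in> maximal_multiple N"
    unfolding maximal_multiple_def by (intro span_sum span_scale span_base) (use assms in blast)
  finally show ?thesis .
qed

text \<open>As \<open>N\<close> is generated in degree \<open>j\<close>, its elements of degree \<open>j + 1\<close> are combinations of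
  generators with linear coefficients.\<close>

lemma degree_Suc_in_maximal_multiple:
  assumes H: "N = span (N \<inter> G j)" and x: "x \<in> N" "x \<in> G (j + 1)"
  shows "x \<in> maximal_multiple N"
proof -
  have "proj (j + 1) x \<in> maximal_multiple N"
  proof (rule proj_span[of x "N \<inter> G j"])
    show "x \<in> span (N \<inter> G j)" using x H by simp
    show "subspace (maximal_multiple N)" by (simp add: maximal_multiple_def)
    fix h assume "h \<in> N \<inter> G j"
    then show "\<exists>e. h \<in> G e \<and> (\<forall>p. act (hcomp (j + 1 - e) p) h \<in> maximal_multiple N)"
      by (intro exI[of _ j]) (auto intro: maximal_multiple_linear)
  qed
  then show ?thesis using x proj_G[of x "j + 1" "j + 1"] by simp
qed

text \<open>Write \<open>\<mm>\<close> for the ideal of the variables.  Adjoining \<open>h\<close> to \<open>N\<close> adds to \<open>\<mm>N\<close> the generators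
  \<open>x\<^sub>v h\<close>.  Let \<open>L\<close> be the colon ideal of \<open>h\<close>.  Then \<open>L h\<close> is contained in \<open>\<mm>N\<close>, because the products of the linear
  generators of \<open>L\<close> with \<open>h\<close> lie in \<open>N\<close> and have degree \<open>j + 1\<close>.  Hence \<open>p x\<^sub>v h\<close> is a combination of
  \<open>\<mm>N\<close> and the preceding \<open>x\<^sub>v\<^sub>' h\<close> exactly if \<open>p x\<^sub>v\<close> lies in the ideal generated by \<open>L\<close> and the
  preceding variables, which is generated by linear forms.\<close>

lemma lin_quot_maximal_multiple:
  "lin_quot act (G j) N \<Longrightarrow> lin_quot act (G (j + 1)) (maximal_multiple N)"
proof (induction rule: lin_quot.induct)
  case zero
  have "maximal_multiple {0} = {0}"
    using maximal_multiple_subset[of "{0}"] span_zero by (auto simp: maximal_multiple_def)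
  then show ?case by (simp add: lin_quot.zero)
next
  case (step N h)
  obtain ls where ls: "set ls \<subseteq> hom_part 1" and colon: "{p. act p h \<in> N} = ideal.span (set ls)"
    using step.hyps by (auto simp: linear_ideal_def)
  have N: "subspace N" "N = span (N \<inter> G j)"
    using lin_quot_subspace[OF step.hyps(1)] lin_quot_span[OF step.hyps(1)] by auto
  let ?mN = "maximal_multiple N"
  have mN: "subspace ?mN" by (simp add: maximal_multiple_def)
  have colon_act: "act p h \<in> ?mN" if "p \<in> ideal.span (set ls)" for p
    using that
  proof (induction rule: ideal.span_induct_alt)
    case base
    then show ?case using mN by (simp add: subspace_0)
  next
    case (step c l p)
    have "act l h \<in> N" using colon step ideal.span_base by blast
    moreover have "act l h \<in> G (j + 1)"
      using G_act[of l 1 h j] ls step \<open>h \<in> G j\<close> by (auto simp: add.commute)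
    ultimately have "act l h \<in> ?mN"
      by (rule degree_Suc_in_maximal_multiple[OF N(2)])
    then show ?case
      using step mN by (simp add: scale_left_distrib scale_scale[symmetric] subspace_add subspace_scale
          del: scale_scale)
  qed
  obtain vs :: "'n list" where vs: "set vs = UNIV"
    using finite_list[OF finite_UNIV] by blast
  let ?z = "\<lambda>v. act (Var v) h"
  have "lin_quot act (G (j + 1)) (span (?mN \<union> set (map ?z vs)))"
  proof (rule lin_quot_list[OF step.IH])
    show "set (map ?z vs) \<subseteq> G (j + 1)"
      using G_act[OF Var_hom_part \<open>h \<in> G j\<close>] by (auto simp: add.commute)
    fix s assume s: "s < length (map ?z vs)"
    let ?A = "set (take s vs)"
    let ?L = "ideal.span (set (ls @ map Var (take s vs)))"
    have forward: "p \<in> ?L" if "act p h \<in> span (N \<union> ?z ` ?A)" for p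
    proof -
      have "\<exists>r \<in> ideal.span (Var ` ?A). x - act r h \<in> N" if "x \<in> span (N \<union> ?z ` ?A)" for x
        using that
      proof (induction rule: span_induct_alt)
        case base
        show ?case by (rule bexI[of _ 0]) (simp_all add: ideal.span_zero subspace_0[OF N(1)])
      next
        case (step c x y)
        then obtain r where r: "r \<in> ideal.span (Var ` ?A)" "y - act r h \<in> N" by blast
        from step consider "x \<in> N" | v where "v \<in> ?A" "x = ?z v" by blast
        then show ?case
        proof cases
          case 1
          have "act c x + (y - act r h) \<in> N"
            using 1 r N by (intro subspace_add subspace_scale)
          then show ?thesis using r by (intro bexI[of _ r]) (simp_all add: algebra_simps)
        next
          case 2
          have "c * Var v + r \<in> ideal.span (Var ` ?A)"
            using 2 r(1) by (intro ideal.span_add ideal.span_scale) (auto intro: ideal.span_base)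
          moreover have "act c x + y - act (c * Var v + r) h \<in> N"
            using r 2 by (simp add: scale_left_distrib)
          ultimately show ?thesis by blast
        qed
      qed
      from this[OF that] obtain r where r: "r \<in> ideal.span (Var ` ?A)" "act p h - act r h \<in> N"
        by blast
      then have "p - r \<in> ideal.span (set ls)"
        using colon by (auto simp: scale_left_diff_distrib)
      then have "(p - r) + r \<in> ?L"
        using r ideal.span_mono[of "set ls" "set (ls @ map Var (take s vs))"]
          ideal.span_mono[of "Var ` ?A" "set (ls @ map Var (take s vs))"]
        by (intro ideal.span_add) auto
      then show ?thesis by simp
    qed
    have backward: "act p h \<in> span (?mN \<union> ?z ` ?A)" if "p \<in> ?L" for p
      using that
    proof (induction rule: ideal.span_induct_alt)
      case base
      then show ?case by (simp add: span_zero)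
    next
      case (step c l p)
      have "act l h \<in> ?mN \<union> ?z ` ?A"
        using step(1) colon_act ideal.span_base[of l "set ls"] by auto
      then show ?case
        using step by (simp add: scale_left_distrib scale_scale[symmetric] span_add span_scale span_base
            del: scale_scale)
    qed
    have "span (?mN \<union> ?z ` ?A) \<subseteq> span (N \<union> ?z ` ?A)"
      using maximal_multiple_subset[OF N(1)] by (intro span_mono) auto
    then have "act p (?z v) \<in> span (?mN \<union> ?z ` ?A) \<longleftrightarrow> p * Var v \<in> ?L" for p v
      using forward[of "p * Var v"] backward[of "p * Var v"] by auto
    then have eq: "{p. act p (map ?z vs ! s) \<in> span (?mN \<union> set (take s (map ?z vs)))}
        = {p. p * Var (vs ! s) \<in> ?L}"
      using s by (simp add: take_map)
    have "linear_ideal ?L"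
      unfolding linear_ideal_def using ls
      by (intro exI[of _ "ls @ map Var (take s vs)"]) auto
    then show "{p. act p (map ?z vs ! s) \<in> span (?mN \<union> set (take s (map ?z vs)))} = UNIV \<or>
        linear_ideal {p. act p (map ?z vs ! s) \<in> span (?mN \<union> set (take s (map ?z vs)))}"
      unfolding eq by (rule linear_ideal_colon)
  qed
  also have "span (?mN \<union> set (map ?z vs)) = maximal_multiple (span (insert h N))"
  proof
    show "span (?mN \<union> set (map ?z vs)) \<subseteq> maximal_multiple (span (insert h N))"
    proof (rule span_minimal)
      have "?mN \<subseteq> maximal_multiple (span (insert h N))"
        unfolding maximal_multiple_def using span_superset[of "insert h N"]
        by (intro span_mono) blast
      moreover have "set (map ?z vs) \<subseteq> maximal_multiple (span (insert h N))"
        using maximal_multiple_linear[OF Var_hom_part] span_base[of h "insert h N"] by auto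
      ultimately show "?mN \<union> set (map ?z vs) \<subseteq> maximal_multiple (span (insert h N))"
        by simp
    qed (simp add: maximal_multiple_def)
    show "maximal_multiple (span (insert h N)) \<subseteq> span (?mN \<union> set (map ?z vs))"
      unfolding maximal_multiple_def[of "span (insert h N)"]
    proof (rule span_minimal)
      show "{act (Var v) x |v x. x \<in> span (insert h N)} \<subseteq> span (?mN \<union> set (map ?z vs))"
      proof clarify
        fix v x assume "x \<in> span (insert h N)"
        then obtain c where c: "x - act c h \<in> span N" by (auto simp: span_insert)
        then have "x - act c h \<in> N" using N(1) by (metis span_eq_iff)
        then have "act (Var v) (x - act c h) \<in> ?mN"
          by (rule maximal_multiple_linear[OF Var_hom_part])
        then have "act (Var v) (x - act c h) \<in> span (?mN \<union> set (map ?z vs))"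
          by (intro span_base) simp
        moreover have "act c (?z v) \<in> span (?mN \<union> set (map ?z vs))"
          by (intro span_scale span_base) (simp add: vs)
        ultimately have "act (Var v) (x - act c h) + act c (?z v) \<in> span (?mN \<union> set (map ?z vs))"
          by (rule span_add)
        then show "act (Var v) x \<in> span (?mN \<union> set (map ?z vs))"
          by (simp add: scale_right_diff_distrib mult.commute)
      qed
    qed simp
  qed
  finally show ?case .
qed

end

section \<open>Linear quotients with generators of increasing degree\<close>

context graded
begin

text \<open>Every monomial of \<open>p\<close> has a factor of degree \<open>j - e\<close>, which takes \<open>h\<close> into degree \<open>j\<close>.\<close>

lemma act_in_span_component:
  assumes p: "p \<in> hom_part s" and h: "h \<in> N" "h \<in> G e" and N: "subspace N"
    and "e \<le> j" "j \<le> s + e"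
  shows "act p h \<in> span (N \<inter> G j)"
proof -
  have "act (Poly_Mapping.single u (coeff p u)) h \<in> span (N \<inter> G j)" if u: "u \<in> supp p" for u
  proof -
    have "nat (j - e) \<le> mdeg u"
      using p u assms by (auto simp: hom_part_def)
    then obtain u1 u2 where u12: "u = u1 + u2" "mdeg u1 = nat (j - e)"
      by (rule monom_split_degree)
    have "act (monom_poly u1) h \<in> N \<inter> G j"
      using G_act[OF monom_poly_hom_part[OF refl] h(2), of u1] u12 \<open>e \<le> j\<close> h N
      by (simp add: subspace_scale)
    then have "act (Const (coeff p u) * monom_poly u2) (act (monom_poly u1) h) \<in> span (N \<inter> G j)"
      by (intro span_scale span_base)
    then show ?thesis
      by (simp add: u12 single_eq_Const_monom monom_poly_add mult_ac)
  qed
  then show ?thesis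
    by (subst poly_eq_sum_terms[of p]) (simp add: scale_sum_left span_sum)
qed

lemma proj_in_span_component:
  assumes H: "\<And>h. h \<in> H \<Longrightarrow> \<exists>e\<le>j. h \<in> G e" and "x \<in> span H" "j \<le> t"
  shows "proj t x \<in> span (span H \<inter> G j)"
proof (rule proj_span[OF assms(2)])
  fix h assume h: "h \<in> H"
  then obtain e where e: "e \<le> j" "h \<in> G e" using H by blast
  have "act (hcomp (t - e) p) h \<in> span (span H \<inter> G j)" for p
    by (rule act_in_span_component[OF hcomp_hom_part])
       (use e h \<open>j \<le> t\<close> in \<open>auto intro: span_base\<close>)
  with e show "\<exists>e. h \<in> G e \<and> (\<forall>p. act (hcomp (t - e) p) h \<in> span (span H \<inter> G j))" by blast
qed simp

lemma colon_homogeneous: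
  assumes H: "H \<subseteq> (\<Union>e. G e)" and h: "h \<in> G e" and p: "act p h \<in> span H"
  shows "act (hcomp t p) h \<in> span H"
proof -
  have "proj (t + e) (act p h) \<in> span H"
  proof (rule proj_span[OF p])
    fix g assume "g \<in> H"
    then show "\<exists>e'. g \<in> G e' \<and> (\<forall>p. act (hcomp (t + e - e') p) g \<in> span H)"
      using H by (blast intro: span_scale span_base)
  qed simp
  then show ?thesis by (simp add: proj_act[OF h])
qed

text \<open>Let \<open>N\<close> be spanned by generators of degree at most \<open>e\<close>, and adjoin \<open>h\<close> of degree \<open>e\<close>.
  Components below degree \<open>e\<close> do not change.  In degree \<open>e\<close> one generator is adjoined to the component
  of \<open>N\<close>, and its colon ideal is that of \<open>h\<close> over \<open>N\<close>, because the multiples of \<open>h\<close> have no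
  components below \<open>e\<close>.  Beyond degree \<open>e\<close> there are no generators, so each
  component spans the multiple by the maximal ideal of what the previous one spans.\<close>

lemma lin_quot_components_insert:
  assumes H: "\<And>g. g \<in> H \<Longrightarrow> \<exists>e'\<le>e. g \<in> G e'" and h: "h \<in> G e"
    and colon: "{p. act p h \<in> span H} = UNIV \<or> linear_ideal {p. act p h \<in> span H}"
    and lq: "\<And>j. lin_quot act (G j) (span (span H \<inter> G j))"
  shows "lin_quot act (G j) (span (span (insert h H) \<inter> G j))"
proof -
  let ?N = "span H" and ?N' = "span (insert h H)"
  have NN': "?N \<subseteq> ?N'" by (rule span_mono) auto
  have H': "\<exists>e'\<le>e. g \<in> G e'" if "g \<in> insert h H" for g
    using that H h by auto
  consider "j < e" | "e \<le> j" by linarith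
  then show ?thesis
  proof cases
    case 1
    have "x \<in> ?N" if x: "x \<in> ?N'" "x \<in> G j" for x
    proof -
      have "proj j x \<in> ?N"
      proof (rule proj_span[OF x(1)])
        fix g assume "g \<in> insert h H"
        then consider "g = h" | "g \<in> H" by blast
        then show "\<exists>e'. g \<in> G e' \<and> (\<forall>p. act (hcomp (j - e') p) g \<in> ?N)"
        proof cases
          case 1
          have "hcomp (j - e) p = 0" for p :: "('n, 'k) polyn"
            using \<open>j < e\<close> by (intro hom_part_negative[OF hcomp_hom_part]) simp
          then show ?thesis using 1 h by (intro exI[of _ e]) (simp add: span_zero)
        next
          case 2
          then show ?thesis using H by (blast intro: span_scale span_base)
        qed
      qed simp
      then show ?thesis using proj_G[OF x(2), of j] by simp
    qed
    then have "?N' \<inter> G j = ?N \<inter> G j" using NN' by blast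
    then show ?thesis using lq[of j] by simp
  next
    case 2
    then show ?thesis
    proof (induction j rule: int_ge_induct)
      case base
      let ?Q = "span (?N \<inter> G e)"
      have Q: "?Q \<subseteq> ?N" by (rule span_minimal) auto
      have "act p h \<in> ?Q" if p: "act p h \<in> ?N" for p
      proof -
        define D where "D = (\<lambda>u. int (mdeg u)) ` supp p"
        have "act (hcomp t p) h \<in> ?Q" if "t \<in> D" for t
        proof -
          have "proj (t + e) (act p h) \<in> ?Q"
            by (rule proj_in_span_component[OF H p]) (use that in \<open>auto simp: D_def\<close>)
          then show ?thesis by (simp add: proj_act[OF h])
        qed
        moreover have "act p h = (\<Sum>t\<in>D. act (hcomp t p) h)"
          using poly_eq_sum_hcomp[of D p] by (simp add: D_def scale_sum_left[symmetric])
        ultimately show ?thesis by (simp add: span_sum)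
      qed
      then have eq: "{p. act p h \<in> ?Q} = {p. act p h \<in> ?N}" using Q by blast
      have "lin_quot act (G e) (span (insert h ?Q))"
        by (rule lin_quot_insert[OF lq h]) (simp add: eq colon)
      also have "span (insert h ?Q) = span (?N' \<inter> G e)"
      proof
        have "?Q \<subseteq> span (?N' \<inter> G e)" using NN' by (intro span_mono) auto
        moreover have "h \<in> span (?N' \<inter> G e)" using h by (auto intro: span_base)
        ultimately show "span (insert h ?Q) \<subseteq> span (?N' \<inter> G e)"
          by (intro span_minimal) auto
        have "x \<in> span (insert h ?Q)" if x: "x \<in> ?N'" "x \<in> G e" for x
        proof -
          have "proj e x \<in> span (insert h ?Q)"
          proof (rule proj_span[OF x(1)])
            fix g assume "g \<in> insert h H"
            then consider "g = h" | "g \<in> H" by blast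
            then show "\<exists>e'. g \<in> G e' \<and> (\<forall>p. act (hcomp (e - e') p) g \<in> span (insert h ?Q))"
            proof cases
              case 1
              then show ?thesis using h by (blast intro: span_scale span_base)
            next
              case 2
              then obtain e' where e': "e' \<le> e" "g \<in> G e'" using H by blast
              have "act (hcomp (e - e') p) g \<in> ?Q" for p
                by (rule act_in_span_component[OF hcomp_hom_part _ e'(2)])
                   (use e' 2 in \<open>auto intro: span_base\<close>)
              then show ?thesis using e' by (blast intro: span_base)
            qed
          qed simp
          then show ?thesis using proj_G[OF x(2), of e] by simp
        qed
        then show "span (?N' \<inter> G e) \<subseteq> span (insert h ?Q)"
          by (intro span_minimal) auto
      qed
      finally show ?case .
    next
      case (step j)
      let ?P = "span (?N' \<inter> G j)"
      have P: "?P \<subseteq> ?N'" by (rule span_minimal) auto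
      have "lin_quot act (G (j + 1)) (maximal_multiple ?P)"
        by (rule lin_quot_maximal_multiple[OF step.IH])
      also have "maximal_multiple ?P = span (?N' \<inter> G (j + 1))"
      proof
        have "act (Var v) x \<in> span (?N' \<inter> G (j + 1))" if "x \<in> ?P" for v x
          using that
        proof (induction rule: span_induct_alt)
          case base
          then show ?case by (simp add: span_zero)
        next
          case (step c y x)
          have "act (Var v) y \<in> ?N' \<inter> G (j + 1)"
            using step G_act[OF Var_hom_part, of y j v] by (simp add: add.commute span_scale)
          then have "act c (act (Var v) y) \<in> span (?N' \<inter> G (j + 1))"
            by (intro span_scale span_base)
          with step show ?case
            by (simp add: scale_right_distrib span_add mult.commute)
        qed
        then show "maximal_multiple ?P \<subseteq> span (?N' \<inter> G (j + 1))"
          unfolding maximal_multiple_def[of ?P] by (intro span_minimal) auto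
        have "x \<in> maximal_multiple ?P" if x: "x \<in> ?N'" "x \<in> G (j + 1)" for x
        proof (rule degree_Suc_in_maximal_multiple[OF lin_quot_span[OF step.IH] _ x(2)])
          have "proj (j + 1) x \<in> ?P"
          proof (rule proj_in_span_component[OF _ x(1)])
            show "\<exists>e'\<le>j. g \<in> G e'" if "g \<in> insert h H" for g
              using H'[OF that] step.hyps by (meson order_trans)
          qed simp
          then show "x \<in> ?P" using proj_G[OF x(2), of "j + 1"] by simp
        qed
        then show "span (?N' \<inter> G (j + 1)) \<subseteq> maximal_multiple ?P"
          by (intro span_minimal) (auto simp: maximal_multiple_def)
      qed
      finally show ?case .
    qed
  qed
qed

text \<open>The generators are adjoined in increasing order; removing the greatest element of an
  initial segment leaves an initial segment, with the same colon ideals.\<close>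

theorem linear_quotients_componentwise_linear:
  fixes less :: "'w \<Rightarrow> 'w \<Rightarrow> bool" and g :: "'w \<Rightarrow> 'b" and e :: "'w \<Rightarrow> int"
  assumes W: "finite W"
    and irrefl: "\<And>w. \<not> less w w" and trans: "\<And>u v w. less u v \<Longrightarrow> less v w \<Longrightarrow> less u w"
    and total: "\<And>u v. u \<noteq> v \<Longrightarrow> less u v \<or> less v u"
    and deg: "\<And>w. w \<in> W \<Longrightarrow> g w \<in> G (e w)" and mono: "\<And>u v. less u v \<Longrightarrow> e u \<le> e v"
    and colon: "\<And>w. w \<in> W \<Longrightarrow> {p. act p (g w) \<in> span (g ` {v \<in> W. less v w})} = UNIV \<or>
      linear_ideal {p. act p (g w) \<in> span (g ` {v \<in> W. less v w})}"
    and M: "M = span (g ` W)"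
  shows "componentwise_linear act M G"
proof -
  have lq: "lin_quot act (G j) (span (span (g ` V) \<inter> G j))"
    if "finite V" and "\<And>w. w \<in> V \<Longrightarrow> g w \<in> G (e w)"
      and "\<And>w. w \<in> V \<Longrightarrow> {p. act p (g w) \<in> span (g ` {v \<in> V. less v w})} = UNIV \<or>
        linear_ideal {p. act p (g w) \<in> span (g ` {v \<in> V. less v w})}" for V j
    using that
  proof (induction "card V" arbitrary: V j)
    case 0
    have "span {} \<inter> G j = {0}" using G_zero by auto
    moreover have "span {0} = {0}" by (simp only: span_eq_iff subspace_single_0)
    ultimately have zero: "span (span {} \<inter> G j) = {0}" by (simp only:)
    have V: "V = {}" using 0 by simp
    show ?case
      unfolding V image_empty zero by (rule lin_quot.zero)
  next
    case (Suc n)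
    then have "V \<noteq> {}" by auto
    with Suc.prems(1) have "\<exists>w\<in>V. \<forall>v\<in>V. v = w \<or> less v w"
      by (intro finite_has_greatest) (simp_all add: total, erule (1) trans)
    then obtain w where w: "w \<in> V" "\<forall>v\<in>V. v = w \<or> less v w"
      by blast
    let ?V = "V - {w}"
    have below_w: "{v \<in> V. less v w} = ?V"
      using w irrefl by auto
    have below: "{v \<in> ?V. less v u} = {v \<in> V. less v u}" if "u \<in> ?V" for u
    proof -
      have "\<not> less w u"
      proof
        assume "less w u"
        moreover have "less u w" using that w by auto
        ultimately show False using trans irrefl by blast
      qed
      then show ?thesis by auto
    qed
    have "n = card ?V"
      using Suc.hyps(2) Suc.prems(1) w by simp
    then have "lin_quot act (G j) (span (span (g ` ?V) \<inter> G j))" for j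
    proof (rule Suc.hyps(1))
      show "finite ?V" using Suc.prems(1) by simp
      fix u assume u: "u \<in> ?V"
      then have "u \<in> V" by simp
      then show "g u \<in> G (e u)" by (rule Suc.prems(2))
      show "{p. act p (g u) \<in> span (g ` {v \<in> ?V. less v u})} = UNIV \<or>
          linear_ideal {p. act p (g u) \<in> span (g ` {v \<in> ?V. less v u})}"
        unfolding below[OF u] by (rule Suc.prems(3)[OF \<open>u \<in> V\<close>])
    qed
    moreover have "\<exists>e'\<le>e w. h \<in> G e'" if "h \<in> g ` ?V" for h
      using that w mono Suc.prems(2) by fastforce
    ultimately have "lin_quot act (G j) (span (span (insert (g w) (g ` ?V)) \<inter> G j))"
      using Suc.prems(2,3)[OF w(1)] by (intro lin_quot_components_insert) (simp_all add: below_w)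
    moreover have "insert (g w) (g ` ?V) = g ` V"
      using w by auto
    ultimately show ?case by simp
  qed
  have "has_linear_resolution act (span (G j)) (\<lambda>t. span (G j) \<inter> G t)" for j
  proof -
    have "span (g ` W) \<inter> G j = G j"
      using G_subset_M M by auto
    then show ?thesis
      using lin_quot_has_linear_resolution[OF lq[OF W deg colon, of j]] by simp
  qed
  then show ?thesis
    unfolding componentwise_linear_def using graded by blast
qed

end

section \<open>Ideals with linear leading monomials\<close>

lemma (in monomial_ordering) lead_monom_diff_less:
  assumes "lead_monom lt p = lead_monom lt q" "p \<noteq> 0" "q \<noteq> 0"
    and "coeff p (lead_monom lt p) = coeff q (lead_monom lt q)" and "p - q \<noteq> 0"
  shows "lt (lead_monom lt (p - q)) (lead_monom lt p)"
proof -
  let ?u = "lead_monom lt (p - q)"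
  have u: "?u \<in> supp (p - q)" by (rule lead_monom_in_supp[OF assms(5)])
  then have "?u \<in> supp p \<or> ?u \<in> supp q"
    by (auto simp: in_keys_iff lookup_minus)
  then have "?u = lead_monom lt p \<or> lt ?u (lead_monom lt p)"
    using lead_monom_greatest[OF assms(2)] lead_monom_greatest[OF assms(3)] assms(1) by auto
  moreover have "?u \<noteq> lead_monom lt p"
    using u assms(1,4) by (auto simp: in_keys_iff lookup_minus)
  ultimately show ?thesis by blast
qed

text \<open>Unless \<open>L\<close> is the whole ring, the leading monomial of every nonzero element is divisible by a
  variable that is itself the leading monomial of a linear form in \<open>L\<close>, namely of the component of
  degree 1 of some element.  Dividing a homogeneous element of \<open>L\<close> by these forms stays in one degree,
  where there are just finitely many monomials, and so ends with remainder 0.\<close>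

theorem (in monomial_ordering) linear_ideal_if_linear_leads:
  fixes L :: "('v, 'k::field) polyn set"
  assumes L: "ideal.subspace L" and hom: "\<And>p t. p \<in> L \<Longrightarrow> hcomp t p \<in> L"
    and lead: "\<And>p. p \<in> L \<Longrightarrow> p \<noteq> 0 \<Longrightarrow>
      \<exists>q\<in>L. \<exists>r. q \<noteq> 0 \<and> mdeg (lead_monom lt q) \<le> 1 \<and> lead_monom lt p = lead_monom lt q + r"
  shows "L = UNIV \<or> linear_ideal L"
proof (cases "1 \<in> L")
  case True
  then have "p * 1 \<in> L" for p by (rule ideal.subspace_scale[OF L])
  then show ?thesis by auto
next
  case False
  define B where "B = {b. \<exists>l\<in>L. l \<in> hom_part 1 \<and> l \<noteq> 0 \<and> lead_monom lt l = mvar b}"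
  have "\<forall>b\<in>B. \<exists>l. l \<in> L \<and> l \<in> hom_part 1 \<and> l \<noteq> 0 \<and> lead_monom lt l = mvar b"
    by (auto simp: B_def)
  from bchoice[OF this] obtain l where
    l: "\<And>b. b \<in> B \<Longrightarrow> l b \<in> L \<and> l b \<in> hom_part 1 \<and> l b \<noteq> 0 \<and> lead_monom lt (l b) = mvar b"
    by blast
  obtain bs where bs: "set bs = B" using finite_list[of B] by auto
  have lead_var: "\<exists>b\<in>B. \<exists>r. lead_monom lt p = mvar b + r" if p: "p \<in> L" "p \<noteq> 0" for p
  proof -
    obtain q r where q: "q \<in> L" "q \<noteq> 0" "mdeg (lead_monom lt q) \<le> 1"
      and r: "lead_monom lt p = lead_monom lt q + r"
      using lead[OF p] by blast
    have "lead_monom lt q \<noteq> 0"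
    proof
      assume zero: "lead_monom lt q = 0"
      have "v = 0" if "v \<in> supp q" for v
        using lead_monom_greatest[OF q(2) that] lt_zero[of v] lt_trans[of v 0 v] lt_irrefl[of v]
        unfolding zero by auto
      then have "q = Const (coeff q 0)"
        by (intro poly_mapping_eqI) (auto simp: Const_def lookup_single when_def in_keys_iff)
      moreover have "coeff q 0 \<noteq> 0"
        using lead_monom_in_supp[OF q(2)] zero by (simp add: in_keys_iff)
      ultimately have "Const (inverse (coeff q 0)) * q = 1"
        by (metis Const_mult Const_1 left_inverse)
      then have "1 \<in> L" using ideal.subspace_scale[OF L q(1)] by metis
      then show False using False by blast
    qed
    then have "mdeg (lead_monom lt q) = 1"
      using q(3) by (simp add: le_Suc_eq)
    then obtain b where b: "lead_monom lt q = mvar b" by (rule mdeg_1_cases)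
    have in_supp: "mvar b \<in> supp (hcomp 1 q)"
      using lead_monom_in_supp[OF q(2)] by (simp add: b in_keys_iff coeff_hcomp)
    then have "lead_monom lt (hcomp 1 q) = mvar b"
    proof (rule lead_monom_eqI)
      fix v assume "v \<in> supp (hcomp 1 q)"
      then have "v \<in> supp q" by (simp add: in_keys_iff coeff_hcomp split: if_split_asm)
      then show "v = mvar b \<or> lt v (mvar b)"
        using lead_monom_greatest[OF q(2)] by (simp add: b)
    qed
    moreover have "hcomp 1 q \<noteq> 0" using in_supp by auto
    ultimately have "b \<in> B"
      unfolding B_def using hom[OF q(1), of 1] hcomp_hom_part by blast
    with r b show ?thesis by auto
  qed
  have homogeneous: "p \<in> ideal.span (set (map l bs))"
    if "p \<in> L" "p \<in> hom_part (int t)" for p t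
    using that
  proof (induction "card {u. mdeg u = t \<and> lt u (lead_monom lt p)}" arbitrary: p rule: less_induct)
    case less
    show ?case
    proof (cases "p = 0")
      case True
      then show ?thesis by (simp add: ideal.span_zero)
    next
      case p: False
      obtain b r where b: "b \<in> B" and r: "lead_monom lt p = mvar b + r"
        using lead_var[OF less.prems(1) p] by blast
      have lead_p: "lead_monom lt p \<in> supp p" by (rule lead_monom_in_supp[OF p])
      have mdeg_lead: "mdeg (lead_monom lt p) = t"
        using lead_p less.prems(2) by (auto simp: hom_part_def)
      define c where "c = coeff p (lead_monom lt p) / coeff (l b) (mvar b)"
      have lb: "coeff (l b) (mvar b) \<noteq> 0"
        using lead_monom_in_supp[of "l b"] l[OF b] by (simp add: in_keys_iff)
      define s where "s = Poly_Mapping.single r c"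
      have "c \<noteq> 0" using lead_p lb by (simp add: c_def in_keys_iff)
      then have lead_s: "lead_monom lt s = r" and s0: "s \<noteq> 0"
        by (simp_all add: s_def) (metis keys_single keys_zero insert_not_empty)
      have sl0: "s * l b \<noteq> 0"
        using no_zero_divisors[of s "l b"] s0 l[OF b] by blast
      have lead_sl: "lead_monom lt (s * l b) = lead_monom lt p"
        using lead_monom_mult[OF s0, of "l b"] l[OF b] lead_s r by (simp add: add.commute)
      have "coeff (s * l b) (lead_monom lt (s * l b)) = coeff p (lead_monom lt p)"
        using coeff_mult_lead[OF s0, of "l b"] lead_monom_mult[OF s0, of "l b"] l[OF b] lead_s lb
        by (simp add: s_def c_def)
      note diff = lead_monom_diff_less[OF lead_sl[symmetric] p sl0 this[symmetric]]
      have sl_span: "s * l b \<in> ideal.span (set (map l bs))"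
        using b bs by (intro ideal.span_scale ideal.span_base) auto
      have "t = Suc (mdeg r)" using mdeg_lead r by simp
      then have "s * l b \<in> hom_part (int t)"
        using hom_part_mult[OF hom_part_single[OF refl, of r c], of "l b" 1] l[OF b]
        by (simp add: s_def add.commute)
      then have hom': "p - s * l b \<in> hom_part (int t)"
        by (rule hom_part_diff[OF less.prems(2)])
      have L': "p - s * l b \<in> L"
        using less.prems(1) l[OF b] L by (intro ideal.subspace_diff ideal.subspace_scale) auto
      have "p - s * l b \<in> ideal.span (set (map l bs))"
      proof (cases "p - s * l b = 0")
        case True
        show ?thesis unfolding True by (rule ideal.span_zero)
      next
        case False
        let ?u = "lead_monom lt (p - s * l b)"
        have lt: "lt ?u (lead_monom lt p)" by (rule diff[OF False])
        have "mdeg ?u = t"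
          using lead_monom_in_supp[OF False] hom' by (auto simp: hom_part_def)
        then have "{u. mdeg u = t \<and> lt u ?u} \<subset> {u. mdeg u = t \<and> lt u (lead_monom lt p)}"
          using lt lt_trans[OF _ lt] lt_irrefl by blast
        then have "card {u. mdeg u = t \<and> lt u ?u} < card {u. mdeg u = t \<and> lt u (lead_monom lt p)}"
          by (intro psubset_card_mono finite_subset[OF _ finite_monoms_of_degree[of t]]) auto
        then show ?thesis by (rule less.hyps[OF _ L' hom'])
      qed
      then have "(p - s * l b) + s * l b \<in> ideal.span (set (map l bs))"
        by (rule ideal.span_add[OF _ sl_span])
      then show ?thesis by simp
    qed
  qed
  have "p \<in> ideal.span (set (map l bs))" if "p \<in> L" for p
  proof -
    define D where "D = (\<lambda>u. int (mdeg u)) ` supp p"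
    have "p = (\<Sum>t\<in>D. hcomp t p)"
      by (rule poly_eq_sum_hcomp) (simp_all add: D_def)
    moreover have "hcomp t p \<in> ideal.span (set (map l bs))" if "t \<in> D" for t
      using homogeneous[OF hom[OF \<open>p \<in> L\<close>, of t], of "nat t"] that by (auto simp: D_def)
    ultimately show ?thesis by (metis (no_types, lifting) ideal.span_sum)
  qed
  moreover have "ideal.span (set (map l bs)) \<subseteq> L"
    by (rule ideal.span_minimal[OF _ L]) (use l bs in auto)
  moreover have "set (map l bs) \<subseteq> hom_part 1"
    using l bs by auto
  ultimately show ?thesis
    unfolding linear_ideal_def by blast
qed

section \<open>Initial ideals\<close>

lemma monom_induct [case_names zero step]:
  fixes u :: "'v::finite monom"
  assumes "P 0" and "\<And>v u. P u \<Longrightarrow> P (mvar v + u)"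
  shows "P u"
proof (induction "mdeg u" arbitrary: u)
  case 0
  then show ?case using assms(1) by simp
next
  case (Suc n)
  then have "u \<noteq> 0" by auto
  then obtain v u' where u: "u = mvar v + u'" by (rule monom_split_var)
  then have "n = mdeg u'" using Suc.hyps(2) by simp
  then show ?case unfolding u by (intro assms(2) Suc.hyps(1))
qed

lemma min_monom_gen_dividing:
  fixes I :: "('v::finite, 'k::field) polyn set"
  assumes "monom_poly u \<in> I"
  shows "\<exists>v\<in>min_monom_gens I. \<exists>r. u = v + r"
  using assms
proof (induction "mdeg u" arbitrary: u rule: less_induct)
  case less
  show ?case
  proof (cases "u \<in> min_monom_gens I")
    case True
    then show ?thesis by (intro bexI[of _ u] exI[of _ 0]) auto
  next
    case False
    then obtain v r where v: "u = v + r" "monom_poly v \<in> I" "v \<noteq> u"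
      using less.prems by (auto simp: min_monom_gens_def)
    then have "r \<noteq> 0" by auto
    then have "mdeg r > 0" using mdeg_eq_0_iff[of r] by linarith
    then have "mdeg v < mdeg u" using v(1) by simp
    then obtain m r' where "m \<in> min_monom_gens I" "v = m + r'"
      using less.hyps v(2) by blast
    moreover from this have "u = m + (r' + r)" using v(1) by (simp add: add.assoc)
    ultimately show ?thesis by blast
  qed
qed

lemma (in monomial_ordering) lead_monom_in_initial_ideal:
  "p \<in> J \<Longrightarrow> p \<noteq> 0 \<Longrightarrow> monom_poly (lead_monom lt p) \<in> initial_ideal lt J"
  unfolding initial_ideal_def by (rule ideal.span_base) blast

text \<open>Every monomial occurring in an element of the initial ideal is a multiple of a leading
  monomial of \<open>J\<close>, and multiples of leading monomials are leading monomials again.\<close>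

lemma (in monomial_ordering) monom_in_initial_idealD:
  fixes J :: "('v, 'k::field) polyn set"
  assumes J: "ideal.subspace J" and u: "monom_poly u \<in> initial_ideal lt J"
  shows "\<exists>p\<in>J. p \<noteq> 0 \<and> lead_monom lt p = u"
proof -
  have "\<exists>p\<in>J. p \<noteq> 0 \<and> (\<exists>r. w = r + lead_monom lt p)"
    if "q \<in> initial_ideal lt J" "w \<in> supp q" for q w
    using that unfolding initial_ideal_def
  proof (induction arbitrary: w rule: ideal.span_induct_alt)
    case base
    then show ?case by simp
  next
    case (step c x y)
    from step(1) obtain p where p: "p \<in> J" "p \<noteq> 0" "x = monom_poly (lead_monom lt p)" by blast
    have "w \<in> supp (c * x) \<or> w \<in> supp y"
      using step.prems keys_add[of "c * x" y] by auto
    then show ?case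
    proof
      assume "w \<in> supp (c * x)"
      then obtain a b where "w = a + b" "b \<in> supp x"
        using subsetD[OF keys_mult] by blast
      then have "w = a + lead_monom lt p" by (simp add: p(3) monom_poly_def)
      with p show ?thesis by blast
    qed (rule step.IH)
  qed
  from this[OF u, of u] obtain p r where p: "p \<in> J" "p \<noteq> 0" "u = r + lead_monom lt p"
    by (auto simp: monom_poly_def)
  have "monom_poly r * p \<in> J" using J p(1) by (rule ideal.subspace_scale)
  moreover have "monom_poly r * p \<noteq> 0" by (rule monom_poly_mult_nonzero[OF p(2)])
  moreover have "lead_monom lt (monom_poly r * p) = u"
    using lead_monom_mult[OF monom_poly_nonzero p(2), of r] p(3) by simp
  ultimately show ?thesis by blast
qed

section \<open>Monomials in two sets of variables\<close>

definition join :: "'n::finite monom \<Rightarrow> 'm::finite monom \<Rightarrow> ('n + 'm) monom" where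
  "join u w = Abs_poly_mapping (case_sum (coeff u) (coeff w))"

lemma coeff_join [simp]:
  "coeff (join u w) (Inl i) = coeff u i" "coeff (join u w) (Inr j) = coeff w j"
  by (simp_all add: join_def)

lemma coeff_xpart [simp]: "coeff (xpart m) i = coeff m (Inl i)"
  by (simp add: xpart_def map_key.rep_eq)

lemma coeff_ypart [simp]: "coeff (ypart m) j = coeff m (Inr j)"
  by (simp add: ypart_def map_key.rep_eq)

lemma monom_sum_eqI:
  fixes m m' :: "('n + 'm) monom"
  assumes "\<And>i. coeff m (Inl i) = coeff m' (Inl i)" "\<And>j. coeff m (Inr j) = coeff m' (Inr j)"
  shows "m = m'"
proof (rule poly_mapping_eqI)
  show "coeff m x = coeff m' x" for x
    using assms by (cases x) auto
qed

lemma xpart_join [simp]: "xpart (join u w) = u"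
  by (rule poly_mapping_eqI) simp

lemma ypart_join [simp]: "ypart (join u w) = w"
  by (rule poly_mapping_eqI) simp

lemma join_parts [simp]: "join (xpart m) (ypart m) = m"
  by (rule monom_sum_eqI) simp_all

lemma join_add: "join (u + u') (w + w') = join u w + join u' w'"
  by (rule monom_sum_eqI) (simp_all add: lookup_add)

lemma join_0 [simp]: "join 0 0 = 0"
  by (rule monom_sum_eqI) simp_all

lemma join_eq_iff: "join u w = m \<longleftrightarrow> u = xpart m \<and> w = ypart m"
  by auto

lemma xpart_add [simp]: "xpart (m + m') = xpart m + xpart m'"
  by (rule poly_mapping_eqI) (simp add: lookup_add)

lemma ypart_add [simp]: "ypart (m + m') = ypart m + ypart m'"
  by (rule poly_mapping_eqI) (simp add: lookup_add)

lemma xpart_0 [simp]: "xpart 0 = 0" and ypart_0 [simp]: "ypart 0 = 0"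
  by (rule poly_mapping_eqI, simp)+

lemma join_mvar_x: "join (mvar i) 0 = mvar (Inl i)"
  by (rule monom_sum_eqI) (simp_all add: mvar_def lookup_single when_def)

lemma join_mvar_y: "join 0 (mvar j) = mvar (Inr j)"
  by (rule monom_sum_eqI) (simp_all add: mvar_def lookup_single when_def)

lemma wt_add [simp]: "wt d (a + b) = wt d a + wt d b"
  by (simp add: wt_def lookup_add distrib_right sum.distrib)

lemma wt_0 [simp]: "wt d 0 = 0"
  by (simp add: wt_def)

lemma wt_mvar [simp]: "wt d (mvar j) = d j"
proof -
  have "wt d (mvar j) = (\<Sum>i\<in>UNIV. if i = j then d j else 0)"
    unfolding wt_def by (intro sum.cong) (auto simp: mvar_def lookup_single when_def)
  then show ?thesis by simp
qed

lemma monomial_order_weight_order: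
  assumes "monomial_order lt"
  shows "monomial_order (weight_order d lt)"
proof -
  interpret monomial_ordering lt by unfold_locales (rule assms)
  show ?thesis
    unfolding monomial_order_def weight_order_def
    by (auto simp: lt_irrefl lt_zero lt_add_right intro: lt_trans dest: lt_total)
qed

lemma monomial_order_product_order:
  fixes lty :: "'m::finite monom \<Rightarrow> 'm monom \<Rightarrow> bool" and ltx :: "'n::finite monom \<Rightarrow> 'n monom \<Rightarrow> bool"
  assumes "monomial_order lty" "monomial_order ltx"
  shows "monomial_order (product_order lty ltx)"
proof -
  interpret y: monomial_ordering lty by unfold_locales (rule assms)
  interpret x: monomial_ordering ltx by unfold_locales (rule assms)
  let ?lt = "product_order lty ltx"
  show ?thesis
    unfolding monomial_order_def
  proof (intro conjI allI impI)
    show "\<not> ?lt u u" for u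
      by (simp add: product_order_def x.lt_irrefl y.lt_irrefl)
    show "?lt u w" if "?lt u v" "?lt v w" for u v w
      using that x.lt_trans[of "xpart u" "xpart v" "xpart w"] y.lt_trans[of "ypart u" "ypart v" "ypart w"]
      unfolding product_order_def by auto
    show total: "?lt u v \<or> ?lt v u" if "u \<noteq> v" for u v
    proof -
      have "xpart u \<noteq> xpart v \<or> ypart u \<noteq> ypart v"
        using that join_parts by metis
      then show ?thesis
        unfolding product_order_def
        using x.lt_total[of "xpart u" "xpart v"] y.lt_total[of "ypart u" "ypart v"]
        by (cases "ypart u = ypart v") auto
    qed
    show "?lt 0 u" if "u \<noteq> 0" for u
    proof (cases "ypart u = 0")
      case True
      then have "xpart u \<noteq> 0" using that join_parts[of u] join_0 by metis
      then show ?thesis using True by (simp add: product_order_def x.lt_zero)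
    next
      case False
      then show ?thesis by (simp add: product_order_def y.lt_zero)
    qed
    show "?lt (u + w) (v + w)" if "?lt u v" for u v w
      using that by (auto simp: product_order_def x.lt_add_right y.lt_add_right)
  qed
qed

text \<open>The product of \<open>p\<close>, viewed as a polynomial in both sets of variables, with the monomial
  \<open>y\<^sup>w\<close>.\<close>

definition lift :: "('n::finite, 'k::field) polyn \<Rightarrow> 'm::finite monom \<Rightarrow> ('n + 'm, 'k) polyn" where
  "lift p w = (\<Sum>u\<in>supp p. Poly_Mapping.single (join u w) (coeff p u))"

lemma coeff_lift: "coeff (lift p w) m = (if ypart m = w then coeff p (xpart m) else 0)"
proof -
  have "coeff (lift p w) m
      = (\<Sum>u\<in>supp p. if u = xpart m then (if ypart m = w then coeff p (xpart m) else 0) else 0)"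
    unfolding lift_def lookup_sum
    by (intro sum.cong) (auto simp: lookup_single when_def join_eq_iff)
  then show ?thesis
    by (auto simp: in_keys_iff)
qed

text \<open>The coefficient of \<open>y\<^sup>w\<close> in \<open>P\<close>, viewed as a polynomial in \<open>y\<close> over \<open>S\<close>.\<close>

definition ycoeff :: "('n::finite + 'm::finite, 'k::field) polyn \<Rightarrow> 'm monom \<Rightarrow> ('n, 'k) polyn" where
  "ycoeff P w = (\<Sum>m\<in>{m\<in>supp P. ypart m = w}. Poly_Mapping.single (xpart m) (coeff P m))"

lemma coeff_ycoeff [simp]: "coeff (ycoeff P w) u = coeff P (join u w)"
proof -
  have "coeff (ycoeff P w) u
      = (\<Sum>m\<in>{m\<in>supp P. ypart m = w}. if m = join u w then coeff P (join u w) else 0)"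
    unfolding ycoeff_def lookup_sum
    by (intro sum.cong) (auto simp: lookup_single when_def)
  then show ?thesis
    by (auto simp: in_keys_iff)
qed

lemma poly_eq_sum_lift_ycoeff: "P = (\<Sum>w\<in>ypart ` supp P. lift (ycoeff P w) w)"
proof (rule poly_mapping_eqI)
  fix m
  have "coeff (lift (ycoeff P w) w) m = (if ypart m = w then coeff P m else 0)" for w
    by (cases "ypart m = w") (auto simp: coeff_lift)
  then have "coeff (\<Sum>w\<in>ypart ` supp P. lift (ycoeff P w) w) m
      = (\<Sum>w\<in>ypart ` supp P. if ypart m = w then coeff P m else 0)"
    by (simp only: lookup_sum)
  also have "\<dots> = (if ypart m \<in> ypart ` supp P then coeff P m else 0)"
    by simp
  also have "\<dots> = coeff P m"
    by (cases "m \<in> supp P") (auto simp: in_keys_iff)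
  finally show "coeff P m = coeff (\<Sum>w\<in>ypart ` supp P. lift (ycoeff P w) w) m" ..
qed

section \<open>Bigraded algebras\<close>

lemma family_sum_add:
  assumes zero: "\<And>i. 0 \<in> G i" and add: "\<And>i x y. x \<in> G i \<Longrightarrow> y \<in> G i \<Longrightarrow> x + y \<in> G i"
    and "x \<in> family_sum G" "y \<in> family_sum G"
  shows "x + y \<in> family_sum G"
proof -
  obtain I u where I: "finite I" "\<forall>i\<in>I. u i \<in> G i" "x = sum u I"
    using assms(3) by (auto simp: family_sum_def)
  obtain J v where J: "finite J" "\<forall>i\<in>J. v i \<in> G i" "y = sum v J"
    using assms(4) by (auto simp: family_sum_def)
  let ?w = "\<lambda>i. (if i \<in> I then u i else 0) + (if i \<in> J then v i else 0)"
  have "sum u I = (\<Sum>i\<in>I\<union>J. if i \<in> I then u i else 0)"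
    by (rule sum.mono_neutral_cong_left) (use I J in auto)
  moreover have "sum v J = (\<Sum>i\<in>I\<union>J. if i \<in> J then v i else 0)"
    by (rule sum.mono_neutral_cong_left) (use I J in auto)
  ultimately have "x + y = sum ?w (I \<union> J)"
    by (simp add: I(3) J(3) sum.distrib)
  moreover have "\<forall>i\<in>I\<union>J. ?w i \<in> G i"
    using I(2) J(2) by (auto intro: zero add)
  moreover have "finite (I \<union> J)" using I J by simp
  ultimately show ?thesis unfolding family_sum_def by blast
qed

lemma family_sum_sum:
  assumes zero: "\<And>i. 0 \<in> G i" and add: "\<And>i x y. x \<in> G i \<Longrightarrow> y \<in> G i \<Longrightarrow> x + y \<in> G i"
    and "\<And>w. w \<in> V \<Longrightarrow> x w \<in> family_sum G"
  shows "sum x V \<in> family_sum G"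
  using assms(3)
proof (induction V rule: infinite_finite_induct)
  case (insert w V)
  then show ?case by (simp add: family_sum_add[OF zero add])
next
  case empty
  have "(0::'b) = sum (\<lambda>_. 0) {} \<and> finite {} \<and> (\<forall>i\<in>{}. 0 \<in> G i)" by simp
  then show ?case unfolding family_sum_def by force
next
  case (infinite V)
  then show ?case unfolding family_sum_def by (auto intro!: exI[of _ "{}"])
qed

locale presented_bigraded_algebra = bigraded_algebra_over_poly scale A \<iota>
  for scale :: "'k::field \<Rightarrow> 'a::comm_ring_1 \<Rightarrow> 'a" and A :: "int \<Rightarrow> nat \<Rightarrow> 'a set"
    and \<iota> :: "('n::finite, 'k) polyn \<Rightarrow> 'a" +
  fixes f :: "'m::finite \<Rightarrow> 'a" and d :: "'m \<Rightarrow> nat" and \<phi> :: "('n + 'm, 'k) polyn \<Rightarrow> 'a"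
  assumes f_degree: "f j \<in> A (int (d j)) 1"
    and f_generate: "bicomp A 1 = module.span (S_act \<iota>) (range f)"
    and \<phi>_hom: "poly_alg_hom scale \<phi>"
    and \<phi>_x: "\<phi> (Var (Inl i)) = \<iota> (Var i)"
    and \<phi>_y: "\<phi> (Var (Inr j)) = f j"
begin

lemma \<iota>_add: "\<iota> (p + q) = \<iota> p + \<iota> q" and \<iota>_mult: "\<iota> (p * q) = \<iota> p * \<iota> q" and \<iota>_1: "\<iota> 1 = 1"
  and \<iota>_Const_mult: "\<iota> (Const c * p) = scale c (\<iota> p)"
  using iota_hom unfolding poly_alg_hom_def by blast+

lemma \<phi>_add: "\<phi> (p + q) = \<phi> p + \<phi> q" and \<phi>_mult: "\<phi> (p * q) = \<phi> p * \<phi> q" and \<phi>_1: "\<phi> 1 = 1"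
  and \<phi>_Const_mult: "\<phi> (Const c * p) = scale c (\<phi> p)"
  using \<phi>_hom unfolding poly_alg_hom_def by blast+

lemma \<iota>_0: "\<iota> 0 = 0"
  using \<iota>_add[of 0 0] by simp

lemma \<phi>_0: "\<phi> 0 = 0"
  using \<phi>_add[of 0 0] by simp

lemma \<iota>_sum: "\<iota> (sum g I) = (\<Sum>i\<in>I. \<iota> (g i))"
  by (induction I rule: infinite_finite_induct) (simp_all add: \<iota>_0 \<iota>_add)

lemma \<phi>_sum: "\<phi> (sum g I) = (\<Sum>i\<in>I. \<phi> (g i))"
  by (induction I rule: infinite_finite_induct) (simp_all add: \<phi>_0 \<phi>_add)

lemma \<phi>_diff: "\<phi> (p - q) = \<phi> p - \<phi> q"
  using \<phi>_add[of "p - q" q] by simp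

lemma kernel_subspace: "ideal.subspace {p. \<phi> p = 0}"
  by (rule ideal.subspaceI) (simp_all add: \<phi>_0 \<phi>_add \<phi>_mult)

sublocale S: poly_module "S_act \<iota>"
  by unfold_locales (simp_all add: S_act_def \<iota>_add \<iota>_mult \<iota>_1 algebra_simps)


definition gen :: "'m monom \<Rightarrow> 'a" where
  "gen w = \<phi> (monom_poly (join 0 w))"

lemma gen_0: "gen 0 = 1"
  by (simp add: gen_def monom_poly_0 \<phi>_1)

lemma gen_add: "gen (w + w') = gen w * gen w'"
proof -
  have "join 0 (w + w') = join (0 :: 'n monom) w + join 0 w'"
    using join_add[of 0 0 w w'] by (simp only: add_0)
  then show ?thesis by (simp add: gen_def monom_poly_add \<phi>_mult)
qed

lemma gen_mvar: "gen (mvar j) = f j"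
  by (simp add: gen_def join_mvar_y Var_def[symmetric] \<phi>_y)

lemma \<phi>_x_monom: "\<phi> (monom_poly (join u 0)) = \<iota> (monom_poly u)"
proof (induction u rule: monom_induct)
  case zero
  then show ?case by (simp add: monom_poly_0 \<phi>_1 \<iota>_1)
next
  case (step i u)
  have "join (mvar i + u) 0 = mvar (Inl i) + join u (0 :: 'm monom)"
    using join_add[of "mvar i" u 0 "0 :: 'm monom"] by (simp add: join_mvar_x)
  then show ?case
    using step \<phi>_x[of i] by (simp add: monom_poly_add \<phi>_mult \<iota>_mult Var_def)
qed

lemma \<phi>_single: "\<phi> (Poly_Mapping.single (join u w) c) = \<iota> (Poly_Mapping.single u c) * gen w"
proof -
  have "join u w = join u 0 + join 0 w"
    using join_add[of u 0 0 w] by simp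
  then have "\<phi> (Poly_Mapping.single (join u w) c)
      = \<phi> (Const c * (monom_poly (join u 0) * monom_poly (join 0 w)))"
    by (simp add: single_eq_Const_monom monom_poly_add)
  also have "\<dots> = scale c (\<iota> (monom_poly u)) * gen w"
    by (subst \<phi>_Const_mult) (simp only: \<phi>_mult \<phi>_x_monom gen_def scale_mult)
  also have "scale c (\<iota> (monom_poly u)) = \<iota> (Poly_Mapping.single u c)"
    by (simp only: single_eq_Const_monom[of u c] \<iota>_Const_mult)
  finally show ?thesis .
qed

lemma \<phi>_lift: "\<phi> (lift p w) = \<iota> p * gen w"
proof -
  have "\<phi> (lift p w) = (\<Sum>u\<in>supp p. \<iota> (Poly_Mapping.single u (coeff p u))) * gen w"
    by (simp add: lift_def \<phi>_sum \<phi>_single sum_distrib_right)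
  also have "(\<Sum>u\<in>supp p. \<iota> (Poly_Mapping.single u (coeff p u))) = \<iota> p"
    unfolding \<iota>_sum[symmetric] by (simp only: poly_eq_sum_terms[symmetric])
  finally show ?thesis .
qed

lemma \<phi>_eq_sum: "\<phi> P = (\<Sum>w\<in>ypart ` supp P. \<iota> (ycoeff P w) * gen w)"
  by (subst poly_eq_sum_lift_ycoeff[of P]) (simp add: \<phi>_sum \<phi>_lift)

lemma gen_degree: "gen w \<in> A (int (wt d w)) (mdeg w)"
proof (induction w rule: monom_induct)
  case zero
  have "scale 1 1 \<in> A 0 0" unfolding A_0_0 by blast
  then show ?case by (simp add: gen_0)
next
  case (step j w)
  show ?case using mult_A[OF f_degree[of j] step] by (simp add: gen_add gen_mvar)
qed

lemma A_zero: "0 \<in> A i j" and A_diff: "x \<in> A i j \<Longrightarrow> y \<in> A i j \<Longrightarrow> x - y \<in> A i j"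
  using direct_sum_A unfolding is_direct_sum_def by auto

lemma A_add: "x \<in> A i j \<Longrightarrow> y \<in> A i j \<Longrightarrow> x + y \<in> A i j"
  using A_diff[of x i j "0 - y"] A_diff[OF A_zero, of y i j] by simp

lemma \<iota>_in_A: "p \<in> hom_part i \<Longrightarrow> \<iota> p \<in> A i 0"
  using iota_graded by blast

lemma A_independent:
  assumes "finite I" "\<And>i j. (i, j) \<in> I \<Longrightarrow> u i j \<in> A i j" "(\<Sum>(i, j)\<in>I. u i j) = 0" "(i, j) \<in> I"
  shows "u i j = 0"
proof -
  have "\<forall>I v. finite I \<longrightarrow> (\<forall>z\<in>I. v z \<in> (case z of (i, j) \<Rightarrow> A i j)) \<longrightarrow> sum v I = 0 \<longrightarrow> (\<forall>z\<in>I. v z = 0)"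
    using direct_sum_A by (simp add: is_direct_sum_def)
  from this[rule_format, of I "\<lambda>(i, j). u i j" "(i, j)"] show ?thesis
    using assms by (auto simp: case_prod_beta)
qed

lemma component_direct_sum: "is_direct_sum (\<lambda>i. A i k) (bicomp A k)"
  unfolding is_direct_sum_def bicomp_def
proof (intro conjI allI ballI impI A_zero A_diff refl)
  fix I and u :: "int \<Rightarrow> 'a" and i
  assume I: "finite I" "\<forall>i\<in>I. u i \<in> A i k" "sum u I = 0" "i \<in> I"
  have "(\<Sum>(i, j)\<in>I \<times> {k}. u i) = sum u I"
    by (simp add: sum.cartesian_product[symmetric])
  then show "u i = 0"
    using I by (intro A_independent[of "I \<times> {k}" "\<lambda>i j. u i" i k]) auto
qed

lemma component_graded:
  assumes "k \<ge> 1"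
  shows "graded (S_act \<iota>) (bicomp A k) (\<lambda>i. A i k)"
proof (rule gradedI, unfold graded_module_def, intro conjI allI ballI component_direct_sum)
  show "module (S_act \<iota>)" by unfold_locales
  show "S.subspace (bicomp A k)" unfolding A_power[OF assms] by (rule S.subspace_span)
  show "S_act \<iota> p u \<in> A (s + t) k" if "p \<in> hom_part s" "u \<in> A t k" for s t p u
    using mult_A[OF \<iota>_in_A[OF that(1)] that(2)] by (simp add: S_act_def)
qed

lemma scaled_gen_in_bicomp: "\<iota> p * gen w \<in> bicomp A (mdeg w)"
proof -
  define D where "D = (\<lambda>u. int (mdeg u)) ` supp p"
  let ?u = "\<lambda>i. \<iota> (hcomp (i - int (wt d w)) p) * gen w"
  have "\<iota> p * gen w = \<iota> (\<Sum>s\<in>D. hcomp s p) * gen w"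
    using poly_eq_sum_hcomp[of D p] by (simp add: D_def)
  also have "\<dots> = (\<Sum>i\<in>(\<lambda>s. s + int (wt d w)) ` D. ?u i)"
    by (simp add: \<iota>_sum sum_distrib_right sum.reindex)
  finally have "\<iota> p * gen w = \<dots>" .
  moreover have "?u i \<in> A i (mdeg w)" for i
    using mult_A[OF \<iota>_in_A[OF hcomp_hom_part] gen_degree, of "i - int (wt d w)" p w] by simp
  moreover have "finite ((\<lambda>s. s + int (wt d w)) ` D)" by (simp add: D_def)
  ultimately show ?thesis unfolding bicomp_def family_sum_def by blast
qed

lemma bicomp_independent:
  assumes K: "finite K" "\<And>k. k \<in> K \<Longrightarrow> x k \<in> bicomp A k" "sum x K = 0" and k: "k \<in> K"
  shows "x k = 0"
proof -
  have "\<forall>k\<in>K. \<exists>I u. x k = sum u I \<and> finite I \<and> (\<forall>i\<in>I. u i \<in> A i k)"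
    using K(2) by (auto simp: bicomp_def family_sum_def)
  from bchoice[OF this] obtain I where
    "\<forall>k\<in>K. \<exists>u. x k = sum u (I k) \<and> finite (I k) \<and> (\<forall>i\<in>I k. u i \<in> A i k)" by blast
  from bchoice[OF this] obtain u where
    u: "\<And>k. k \<in> K \<Longrightarrow> x k = sum (u k) (I k) \<and> finite (I k) \<and> (\<forall>i\<in>I k. u k i \<in> A i k)" by blast
  let ?P = "prod.swap ` (SIGMA k:K. I k)"
  have "(\<Sum>(i, k)\<in>?P. u k i) = (\<Sum>(k, i)\<in>(SIGMA k:K. I k). u k i)"
    by (subst sum.reindex) (auto simp: case_prod_beta)
  also have "\<dots> = (\<Sum>k\<in>K. sum (u k) (I k))"
    by (rule sum.Sigma[symmetric]) (use K u in auto)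
  also have "\<dots> = sum x K"
    by (intro sum.cong) (auto simp: u)
  finally have "(\<Sum>(i, k)\<in>?P. u k i) = 0" using K(3) by simp
  then have "u k i = 0" if "i \<in> I k" for i
    by (intro A_independent[of ?P "\<lambda>i k. u k i" i k]) (use K u k that in \<open>auto intro!: finite_SigmaI\<close>)
  then show ?thesis using u[OF k] by simp
qed

text \<open>The parts of \<open>P\<close> of different \<open>y\<close>-degrees are mapped to different components \<open>A\<^sub>k\<close>, so
  they lie in the kernel separately.\<close>

lemma kernel_homogeneous:
  assumes "\<phi> P = 0"
  shows "(\<Sum>w\<in>{w \<in> ypart ` supp P. mdeg w = k}. \<iota> (ycoeff P w) * gen w) = 0"
proof -
  let ?V = "ypart ` supp P"
  let ?y = "\<lambda>w. \<iota> (ycoeff P w) * gen w"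
  let ?x = "\<lambda>k. \<Sum>w\<in>{w\<in>?V. mdeg w = k}. ?y w"
  show ?thesis
  proof (cases "k \<in> mdeg ` ?V")
    case False
    then have "{w \<in> ?V. mdeg w = k} = {}" by blast
    then show ?thesis by (simp only: sum.empty)
  next
    case True
    show ?thesis
    proof (rule bicomp_independent[of "mdeg ` ?V" ?x])
      have "(\<Sum>k\<in>mdeg ` ?V. ?x k) = (\<Sum>w\<in>?V. ?y w)"
        by (rule sum.image_gen[symmetric]) simp
      then show "(\<Sum>k\<in>mdeg ` ?V. ?x k) = 0"
        using assms by (simp add: \<phi>_eq_sum)
      fix k
      have "?y w \<in> family_sum (\<lambda>i. A i k)" if "mdeg w = k" for w
        using scaled_gen_in_bicomp[of "ycoeff P w" w] that by (simp add: bicomp_def)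
      then show "?x k \<in> bicomp A k"
        unfolding bicomp_def by (intro family_sum_sum A_zero A_add) auto
    qed (use True in auto)
  qed
qed

lemma component_span:
  assumes "k \<ge> 1"
  shows "bicomp A k = S.span (gen ` {w. mdeg w = k})"
proof
  interpret C: graded "S_act \<iota>" "bicomp A k" "\<lambda>i. A i k" by (rule component_graded[OF assms])
  have "gen w \<in> bicomp A k" if "mdeg w = k" for w
    using C.G_subset_M[of "int (wt d w)"] gen_degree[of w] that by blast
  then show "S.span (gen ` {w. mdeg w = k}) \<subseteq> bicomp A k"
    by (intro S.span_minimal C.subspace_M) auto
  have mult_f: "a * f j \<in> S.span (gen ` {w. mdeg w = Suc n})"
    if "a \<in> S.span (gen ` {w. mdeg w = n})" for a j n
    using that
  proof (induction rule: S.span_induct_alt)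
    case base
    then show ?case by (simp add: S.span_zero)
  next
    case (step c x y)
    then obtain w where w: "mdeg w = n" "x = gen w" by blast
    have "(S_act \<iota> c x + y) * f j = S_act \<iota> c (gen (w + mvar j)) + y * f j"
      by (simp add: S_act_def w(2) gen_add gen_mvar algebra_simps)
    moreover have "gen (w + mvar j) \<in> S.span (gen ` {w. mdeg w = Suc n})"
      by (rule S.span_base) (use w(1) in simp)
    ultimately show ?case
      using step.IH by (simp add: S.span_add S.span_scale)
  qed
  have mult: "a * b \<in> S.span (gen ` {w. mdeg w = Suc n})"
    if a: "a \<in> S.span (gen ` {w. mdeg w = n})" and b: "b \<in> S.span (range f)" for a b n
    using b
  proof (induction rule: S.span_induct_alt)
    case base
    then show ?case by (simp add: S.span_zero)
  next
    case (step c x y)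
    have "a * (S_act \<iota> c x + y) = S_act \<iota> c (a * x) + a * y"
      by (simp add: S_act_def algebra_simps)
    moreover have "a * x \<in> S.span (gen ` {w. mdeg w = Suc n})"
      using mult_f[OF a] step(1) by auto
    ultimately show ?case
      using step.IH by (simp add: S.span_add S.span_scale)
  qed
  have "(\<Prod>l<n. g l) \<in> S.span (gen ` {w. mdeg w = n})"
    if "\<forall>l<n. g l \<in> bicomp A 1" for n g
    using that
  proof (induction n)
    case 0
    show ?case by (auto simp: gen_0 intro: S.span_base)
  next
    case (Suc n)
    then show ?case using mult f_generate by simp
  qed
  then show "bicomp A k \<subseteq> S.span (gen ` {w. mdeg w = k})"
    unfolding A_power[OF assms] by (intro S.span_minimal) auto
qed

lemma span_gen_coefficients:
  assumes "finite V" "x \<in> S.span (gen ` V)"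
  shows "\<exists>c. x = (\<Sum>v\<in>V. \<iota> (c v) * gen v)"
  using assms(2)
proof (induction rule: S.span_induct_alt)
  case base
  show ?case by (rule exI[of _ "\<lambda>_. 0"]) (simp add: \<iota>_0)
next
  case (step p x y)
  then obtain w c where w: "w \<in> V" "x = gen w" and c: "y = (\<Sum>v\<in>V. \<iota> (c v) * gen v)" by blast
  have "(\<Sum>v\<in>V. \<iota> ((if v = w then p else 0) + c v) * gen v)
      = (\<Sum>v\<in>V. (if v = w then \<iota> p * gen w else 0) + \<iota> (c v) * gen v)"
    by (intro sum.cong) (auto simp: \<iota>_add \<iota>_0 distrib_right)
  also have "\<dots> = S_act \<iota> p x + y"
    using assms(1) w by (simp add: sum.distrib c S_act_def)
  finally show ?case
    by (intro exI[of _ "\<lambda>v. (if v = w then p else 0) + c v"]) (rule sym)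
qed

text \<open>Leading monomials pass between the colon ideal and the initial ideal of the kernel as follows.  A relation
  \<open>p g\<^sub>w = \<Sum> c\<^sub>v g\<^sub>v\<close> with smaller \<open>v\<close> gives an element \<open>P\<close> of the kernel with leading monomial
  \<open>u w\<close>, where \<open>u\<close> is the leading monomial of \<open>p\<close>.  It is divisible by a minimal generator \<open>m\<close>, whose
  \<open>x\<close>-part \<open>u'\<close> has degree at most 1.  Multiplying \<open>m\<close> by a monomial in \<open>y\<close> shows that \<open>u' w\<close> is
  the leading monomial of some \<open>Q\<close> in the kernel.  The part of \<open>Q\<close> of \<open>y\<close>-degree \<open>k\<close> is a relation
  among the generators in which \<open>g\<^sub>w\<close> comes last; its coefficient lies in the colon ideal and
  has leading monomial \<open>u'\<close>, which divides \<open>u\<close>.\<close>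

lemma colon_linear:
  assumes lty: "monomial_order lty" and ltx: "monomial_order ltx"
    and x_cond: "x_condition (product_order lty ltx) {P. \<phi> P = 0}"
    and k: "k \<ge> 1" and w: "mdeg w = k"
  shows "{p. S_act \<iota> p (gen w) \<in> S.span (gen ` {v \<in> {v. mdeg v = k}. lty v w})} = UNIV \<or>
    linear_ideal {p. S_act \<iota> p (gen w) \<in> S.span (gen ` {v \<in> {v. mdeg v = k}. lty v w})}"
proof -
  let ?lt = "product_order lty ltx" and ?J = "{P. \<phi> P = 0}"
  let ?V = "{v \<in> {v. mdeg v = k}. lty v w}"
  let ?L = "{p. S_act \<iota> p (gen w) \<in> S.span (gen ` ?V)}"
  interpret Y: monomial_ordering lty by unfold_locales (rule lty)
  interpret X: monomial_ordering ltx by unfold_locales (rule ltx)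
  interpret T: monomial_ordering ?lt
    by unfold_locales (rule monomial_order_product_order[OF lty ltx])
  interpret C: graded "S_act \<iota>" "bicomp A k" "\<lambda>i. A i k" by (rule component_graded[OF k])
  have V: "finite ?V" by (rule finite_subset[OF _ finite_monoms_of_degree[of k]]) blast
  show ?thesis
  proof (rule X.linear_ideal_if_linear_leads)
    show "ideal.subspace ?L"
      by (rule ideal.subspaceI)
         (simp_all add: S.span_zero S.scale_left_distrib S.span_add S.scale_scale[symmetric] S.span_scale
           del: S.scale_scale)
    show "hcomp t p \<in> ?L" if "p \<in> ?L" for p t
    proof -
      have "gen ` ?V \<subseteq> (\<Union>e. A e k)" using gen_degree by blast
      from C.colon_homogeneous[OF this, of "gen w" "int (wt d w)" p t] that gen_degree[of w] w
      show ?thesis by simp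
    qed
    fix p assume p: "p \<in> ?L" "p \<noteq> 0"
    obtain c where c: "\<iota> p * gen w = (\<Sum>v\<in>?V. \<iota> (c v) * gen v)"
      using span_gen_coefficients[OF V] p(1) unfolding S_act_def by blast
    define P where "P = lift p w - (\<Sum>v\<in>?V. lift (c v) v)"
    have "\<phi> P = 0"
      by (simp add: P_def \<phi>_diff \<phi>_sum \<phi>_lift c)
    have coeff_P: "coeff P m = (if ypart m = w then coeff p (xpart m) else 0)
        - (if ypart m \<in> ?V then coeff (c (ypart m)) (xpart m) else 0)" for m
      using V by (simp add: P_def lookup_minus lookup_sum coeff_lift)
    have lead_in: "join (lead_monom ltx p) w \<in> supp P"
      using X.lead_monom_in_supp[OF p(2)] by (simp add: in_keys_iff coeff_P Y.lt_irrefl)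
    then have P0: "P \<noteq> 0" by auto
    have lead_P: "lead_monom ?lt P = join (lead_monom ltx p) w"
    proof (rule T.lead_monom_eqI[OF lead_in])
      fix m assume m: "m \<in> supp P"
      show "m = join (lead_monom ltx p) w \<or> ?lt m (join (lead_monom ltx p) w)"
      proof (cases "ypart m = w")
        case True
        then have "xpart m \<in> supp p"
          using m by (simp add: in_keys_iff coeff_P Y.lt_irrefl)
        from X.lead_monom_greatest[OF p(2) this] show ?thesis
        proof
          assume "xpart m = lead_monom ltx p"
          then have "m = join (lead_monom ltx p) w" using True join_parts[of m] by simp
          then show ?thesis ..
        next
          assume "ltx (xpart m) (lead_monom ltx p)"
          then show ?thesis using True by (simp add: product_order_def)
        qed
      next
        case False
        then have "ypart m \<in> ?V"
          using m by (simp add: in_keys_iff coeff_P split: if_split_asm)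
        then show ?thesis by (simp add: product_order_def)
      qed
    qed
    have "monom_poly (join (lead_monom ltx p) w) \<in> initial_ideal ?lt ?J"
      using T.lead_monom_in_initial_ideal[of P ?J] P0 \<open>\<phi> P = 0\<close> lead_P by simp
    from min_monom_gen_dividing[OF this] obtain m r
      where m: "m \<in> min_monom_gens (initial_ideal ?lt ?J)"
        and r: "join (lead_monom ltx p) w = m + r" by blast
    have m_deg: "mdeg (xpart m) \<le> 1"
      using x_cond m by (simp add: x_condition_def)
    have "lead_monom ltx p = xpart (m + r)" "w = ypart (m + r)"
      unfolding r[symmetric] by simp_all
    then have lead_p: "lead_monom ltx p = xpart m + xpart r" and w_eq: "w = ypart m + ypart r"
      by simp_all
    have "join (xpart m) w = join 0 (ypart r) + m"
      by (rule monom_sum_eqI) (simp_all add: w_eq lookup_add)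
    moreover have "monom_poly m \<in> initial_ideal ?lt ?J"
      using m by (simp add: min_monom_gens_def)
    ultimately have "monom_poly (join (xpart m) w) \<in> initial_ideal ?lt ?J"
      unfolding initial_ideal_def by (simp add: monom_poly_add ideal.span_scale)
    from T.monom_in_initial_idealD[OF kernel_subspace this] obtain Q
      where Q: "\<phi> Q = 0" "Q \<noteq> 0" "lead_monom ?lt Q = join (xpart m) w" by blast
    define q where "q = ycoeff Q w"
    have lead_Q: "join (xpart m) w \<in> supp Q"
      using T.lead_monom_in_supp[OF Q(2)] Q(3) by simp
    have q_supp: "xpart m \<in> supp q"
      using lead_Q by (simp add: q_def in_keys_iff)
    then have q0: "q \<noteq> 0" by auto
    have below: "ypart m' = w \<or> lty (ypart m') w" if "m' \<in> supp Q" for m'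
      using T.lead_monom_greatest[OF Q(2) that] unfolding Q(3) by (auto simp: product_order_def)
    have lead_q: "lead_monom ltx q = xpart m"
    proof (rule X.lead_monom_eqI[OF q_supp])
      fix u assume "u \<in> supp q"
      then have "join u w \<in> supp Q" by (simp add: q_def in_keys_iff)
      from T.lead_monom_greatest[OF Q(2) this] show "u = xpart m \<or> ltx u (xpart m)"
        unfolding Q(3) using Y.lt_irrefl by (auto simp: product_order_def join_eq_iff)
    qed
    have q_L: "q \<in> ?L"
    proof -
      let ?U = "{v \<in> ypart ` supp Q. mdeg v = k}"
      have w_U: "w \<in> ?U" using lead_Q w by (force intro: image_eqI[of _ ypart])
      have U: "?U - {w} \<subseteq> ?V" using below by auto
      have "(\<Sum>v\<in>?U. \<iota> (ycoeff Q v) * gen v) = 0" by (rule kernel_homogeneous[OF Q(1)])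
      then have "\<iota> q * gen w = - (\<Sum>v\<in>?U - {w}. \<iota> (ycoeff Q v) * gen v)"
        using w_U by (simp add: sum.remove[of ?U w] q_def eq_neg_iff_add_eq_0)
      also have "\<dots> \<in> S.span (gen ` ?V)"
      proof (intro S.span_neg S.span_sum)
        fix v assume "v \<in> ?U - {w}"
        then have "gen v \<in> S.span (gen ` ?V)" using U by (blast intro: S.span_base)
        from S.span_scale[OF this] show "\<iota> (ycoeff Q v) * gen v \<in> S.span (gen ` ?V)"
          by (simp add: S_act_def)
      qed
      finally show ?thesis by (simp add: S_act_def)
    qed
    show "\<exists>q\<in>?L. \<exists>r. q \<noteq> 0 \<and> mdeg (lead_monom ltx q) \<le> 1 \<and>
        lead_monom ltx p = lead_monom ltx q + r"
      by (rule bexI[OF _ q_L], rule exI[of _ "xpart r"])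
         (use q0 m_deg lead_q lead_p in \<open>simp only: simp_thms\<close>)
  qed
qed

theorem component_componentwise_linear:
  assumes lt_star: "monomial_order lt_star" and ltx: "monomial_order ltx"
    and x_cond: "x_condition (product_order (weight_order d lt_star) ltx) {P. \<phi> P = 0}"
    and k: "k \<ge> 1"
  shows "componentwise_linear (S_act \<iota>) (bicomp A k) (\<lambda>i. A i k)"
proof -
  let ?lt = "weight_order d lt_star"
  have lty: "monomial_order ?lt" by (rule monomial_order_weight_order[OF lt_star])
  interpret Y: monomial_ordering ?lt by unfold_locales (rule lty)
  interpret C: graded "S_act \<iota>" "bicomp A k" "\<lambda>i. A i k" by (rule component_graded[OF k])
  show ?thesis
  proof (rule C.linear_quotients_componentwise_linear[of "{w. mdeg w = k}" ?lt gen "\<lambda>w. int (wt d w)"])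
    show "finite {w :: 'm monom. mdeg w = k}" by (rule finite_monoms_of_degree)
    show "\<not> ?lt w w" for w by (rule Y.lt_irrefl)
    show "?lt u w" if "?lt u v" "?lt v w" for u v w using that by (rule Y.lt_trans)
    show "?lt u v \<or> ?lt v u" if "u \<noteq> v" for u v using that by (rule Y.lt_total)
    show "gen w \<in> A (int (wt d w)) k" if "w \<in> {w. mdeg w = k}" for w
      using gen_degree[of w] that by simp
    show "int (wt d u) \<le> int (wt d v)" if "?lt u v" for u v
      using that by (auto simp: weight_order_def)
    show "bicomp A k = S.span (gen ` {w. mdeg w = k})" by (rule component_span[OF k])
    show "{p. S_act \<iota> p (gen w) \<in> S.span (gen ` {v \<in> {w. mdeg w = k}. ?lt v w})} = UNIV \<or>
        linear_ideal {p. S_act \<iota> p (gen w) \<in> S.span (gen ` {v \<in> {w. mdeg w = k}. ?lt v w})}"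
      if "w \<in> {w. mdeg w = k}" for w
      by (rule colon_linear[OF lty ltx x_cond k]) (use that in simp)
  qed
qed

end

theorem corollary2p7:
  fixes scale :: "'k::field \<Rightarrow> 'a::comm_ring_1 \<Rightarrow> 'a"
    and A :: "int \<Rightarrow> nat \<Rightarrow> 'a set"
    and \<iota> :: "('n::finite, 'k) polyn \<Rightarrow> 'a"
    and f :: "'m::{finite,linorder} \<Rightarrow> 'a"
    and d :: "'m \<Rightarrow> nat"
    and \<phi> :: "('n + 'm, 'k) polyn \<Rightarrow> 'a"
    and lt_star :: "'m monom \<Rightarrow> 'm monom \<Rightarrow> bool"
    and lt_x :: "'n monom \<Rightarrow> 'n monom \<Rightarrow> bool"
  assumes "bigraded_algebra_over_poly scale A \<iota>"
    and "\<And>j. f j \<in> A (int (d j)) 1"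
    and "bicomp A 1 = module.span (S_act \<iota>) (range f)"
    and "mono d"
    and "poly_alg_hom scale \<phi>"
    and "\<And>i. \<phi> (Var (Inl i)) = \<iota> (Var i)"
    and "\<And>j. \<phi> (Var (Inr j)) = f j"
    and "monomial_order lt_star"
    and "\<And>i j. i < j \<Longrightarrow> lt_star (mvar i) (mvar j)"
    and "monomial_order lt_x"
    and "x_condition (product_order (weight_order d lt_star) lt_x) {p. \<phi> p = 0}"
  shows "\<forall>k\<ge>1. componentwise_linear (S_act \<iota>) (bicomp A k) (\<lambda>i. A i k)"
proof -
  interpret presented_bigraded_algebra scale A \<iota> f d \<phi>
    by (rule presented_bigraded_algebra.intro[OF assms(1)], unfold_locales) (rule assms)+
  show ?thesis
    using component_componentwise_linear[OF assms(8,10,11)] by blast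
qed

end
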